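(* Let $a=19708$. For any $L,\mu,\Delta,\epsilon>0$ and $\gamma$ with $L\ge194a\mu$, $\gamma\in(0,1]$ and $\epsilon<0.01\Delta$, put $\kappa=L/\mu$. Then there exist a number of agents $n$, a connected network of $n$ agents with a mixing matrix $\mathbf{W}\in\mathbb{R}^{n\times n}$ satisfying $1-\lambda_2(\mathbf{W})\ge\gamma$, and an $L$-mean-squared smooth function set $\{f_i:\mathbb{R}^d\to\mathbb{R}\}_{i=1}^n$ with $d=O(\kappa\log(1/\epsilon))$, such that $f=\frac1n\sum_{i=1}^nf_i$ is $\mu$-PL with $f(\mathbf{0})-f^*\le\Delta$, where $f^*=\inf_{\mathbf{y}\in\mathbb{R}^d} f(\mathbf{y})$, the spectral gap $\gamma(\mathbf{W})=1-\lambda_2(\mathbf{W})$ equals $\gamma$, and, in order to find an $\epsilon$-suboptimal solution of $\min_{\mathbf{x}\in\mathbb{R}^d}f(\mathbf{x})$, any DFO algorithm over this network needs at least $\Omega\big((\kappa/\sqrt{\gamma})\log(1/\epsilon)\big)$ communication rounds and $\Omega\big(\kappa\log(1/\epsilon)(1+\tau/\sqrt{\gamma})\big)$ time cost, where $\tau>0$ is the time cost of one communication round.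
   Context: $\|\cdot\|$ is the Euclidean norm. $\{f_i\}_{i=1}^n$ is $L$-mean-squared smooth if $\frac1n\sum_{i=1}^n\|\nabla f_i(\mathbf{x})-\nabla f_i(\mathbf{y})\|^2\le L^2\|\mathbf{x}-\mathbf{y}\|^2$ for all $\mathbf{x},\mathbf{y}\in\mathbb{R}^d$. A differentiable function $f$ that is bounded below is $\mu$-PL if $f(\mathbf{x})-\inf_{\mathbf{y}}f(\mathbf{y})\le\frac{1}{2\mu}\|\nabla f(\mathbf{x})\|^2$ for all $\mathbf{x}$. A point $\hat{\mathbf{x}}$ is $\epsilon$-suboptimal if $f(\hat{\mathbf{x}})-f^*\le\epsilon$. Mixing matrix: $\mathbf{W}\in\mathbb{R}^{n\times n}$ is a mixing matrix of the network if (a) $\mathbf{W}=\mathbf{W}^\top$, $\mathbf{W}\mathbf{1}=\mathbf{1}$ and $\mathbf{0}\preceq\mathbf{W}\preceq\mathbf{I}$; (b) $w_{i,j}>0$ if agents $i$ and $j$ are connected or $i=j$, and $w_{i,j}=0$ otherwise. $\lambda_2(\mathbf{W})$ is the second-largest eigenvalue. DFO algorithm: a decentralized first-order oracle (DFO) algorithm over a network of $n$ agents, where agent $i$ holds $f_i$, satisfies the following. (Local memory) Agent $i$ has at time $s$ a local memory $\mathcal{M}_i^s$, with $\mathcal{M}_i^s\subset\mathcal{M}_{\mathrm{comp},i}^s\cup\mathcal{M}_{\mathrm{comm},i}^s$ for $s>0$; initially $\mathcal{M}_i^0=\{\mathbf{0}\}$. (Local computation, costing one unit of time and possibly performed in parallel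 by several agents) $\mathcal{M}_{\mathrm{comp},i}^s=\mathrm{Lin}(\{\mathbf{x},\nabla f_i(\mathbf{x}):\mathbf{x}\in\mathcal{M}_i^{s-1}\})$. (Local communication, each round costing time $\tau$) $\mathcal{M}_{\mathrm{comm},i}^s=\mathrm{Lin}\big(\bigcup_{j\in\mathrm{nbr}(i)}\mathcal{M}_j^{s-\tau}\big)$ for $\tau<s$, where $\mathrm{nbr}(i)$ is the set of neighbours of agent $i$. (Output) Agent $i$ can specify a vector $\mathbf{x}_i^s\in\mathcal{M}_i^s$ as its local output at time $s$. $\mathrm{Lin}$ is the linear span. Finding an $\epsilon$-suboptimal solution means that some local output is $\epsilon$-suboptimal. Asymptotic convention: $O$ and $\Omega$ hide positive constants that may depend on $\Delta$ but not on $L,\mu,\gamma,\tau,\epsilon$; in the $O$-bound, $\log(1/\epsilon)$ is read as $\max\{1,\log(1/\epsilon)\}$. *)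

theory Defs
  imports
    "Jordan_Normal_Form.Char_Poly"
    "Jordan_Normal_Form.VS_Connect"
begin

text \<open>The dimension \<open>d\<close> and the number of agents \<open>n\<close> are existentially quantified numbers, so
  \<open>\<real>\<^sup>d\<close> is the carrier \<^term>\<open>carrier_vec d :: real vec set\<close>, and a function on \<open>\<real>\<^sup>d\<close> is a
  HOL function of which only the values on that carrier matter. Agents are the numbers
  \<open>0, \<dots>, n - 1\<close>.\<close>

section \<open>Smooth functions on \<open>\<real>\<^sup>d\<close>\<close>

definition vnorm :: "real vec \<Rightarrow> real" where
  "vnorm v = sqrt (v \<bullet> v)"

text \<open>Frechet differentiability at \<open>x\<close>, with the derivative represented by the vector \<open>g\<close>.\<close>

definition has_gradient :: "nat \<Rightarrow> (real vec \<Rightarrow> real) \<Rightarrow> real vec \<Rightarrow> real vec \<Rightarrow> bool" where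
  "has_gradient d f g x \<longleftrightarrow> g \<in> carrier_vec d \<and>
     (\<forall>e>0. \<exists>\<delta>>0. \<forall>h\<in>carrier_vec d. vnorm h < \<delta> \<longrightarrow>
        \<bar>f (x + h) - f x - g \<bullet> h\<bar> \<le> e * vnorm h)"

definition differentiable_fun :: "nat \<Rightarrow> (real vec \<Rightarrow> real) \<Rightarrow> bool" where
  "differentiable_fun d f \<longleftrightarrow> (\<forall>x\<in>carrier_vec d. \<exists>g. has_gradient d f g x)"

definition gradient :: "nat \<Rightarrow> (real vec \<Rightarrow> real) \<Rightarrow> real vec \<Rightarrow> real vec" where
  "gradient d f x = (THE g. has_gradient d f g x)"

definition mean_squared_smooth ::
  "nat \<Rightarrow> nat \<Rightarrow> real \<Rightarrow> (nat \<Rightarrow> real vec \<Rightarrow> real) \<Rightarrow> bool" where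
  "mean_squared_smooth n d L f \<longleftrightarrow>
     (\<forall>i<n. differentiable_fun d (f i)) \<and>
     (\<forall>x\<in>carrier_vec d. \<forall>y\<in>carrier_vec d.
        (1 / real n) * (\<Sum>i<n. (vnorm (gradient d (f i) x - gradient d (f i) y))\<^sup>2)
          \<le> L\<^sup>2 * (vnorm (x - y))\<^sup>2)"

definition average :: "nat \<Rightarrow> (nat \<Rightarrow> real vec \<Rightarrow> real) \<Rightarrow> real vec \<Rightarrow> real" where
  "average n f x = (1 / real n) * (\<Sum>i<n. f i x)"

definition inf_value :: "nat \<Rightarrow> (real vec \<Rightarrow> real) \<Rightarrow> real" where
  "inf_value d f = (INF y\<in>carrier_vec d. f y)"

definition PL :: "nat \<Rightarrow> real \<Rightarrow> (real vec \<Rightarrow> real) \<Rightarrow> bool" where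
  "PL d \<mu> f \<longleftrightarrow> differentiable_fun d f \<and> bdd_below (f ` carrier_vec d) \<and>
     (\<forall>x\<in>carrier_vec d. f x - inf_value d f \<le> 1 / (2 * \<mu>) * (vnorm (gradient d f x))\<^sup>2)"

definition suboptimal :: "nat \<Rightarrow> (real vec \<Rightarrow> real) \<Rightarrow> real \<Rightarrow> real vec \<Rightarrow> bool" where
  "suboptimal d f \<epsilon> x \<longleftrightarrow> f x - inf_value d f \<le> \<epsilon>"

section \<open>Networks and mixing matrices\<close>

definition connected_network :: "nat \<Rightarrow> (nat \<times> nat) set \<Rightarrow> bool" where
  "connected_network n E \<longleftrightarrow> E \<subseteq> {..<n} \<times> {..<n} \<and> sym E \<and> irrefl E \<and>
     (\<forall>i<n. \<forall>j<n. (i, j) \<in> E\<^sup>*)"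

definition psd :: "nat \<Rightarrow> real mat \<Rightarrow> bool" where
  "psd n A \<longleftrightarrow> A \<in> carrier_mat n n \<and> transpose_mat A = A \<and>
     (\<forall>v\<in>carrier_vec n. 0 \<le> v \<bullet> (A *\<^sub>v v))"

definition mixing_matrix :: "nat \<Rightarrow> (nat \<times> nat) set \<Rightarrow> real mat \<Rightarrow> bool" where
  "mixing_matrix n E W \<longleftrightarrow>
     W \<in> carrier_mat n n \<and> transpose_mat W = W \<and>
     W *\<^sub>v vec n (\<lambda>_. 1) = vec n (\<lambda>_. 1) \<and>
     psd n W \<and> psd n (1\<^sub>m n - W) \<and>
     (\<forall>i<n. \<forall>j<n. if (i, j) \<in> E \<or> i = j then W $$ (i, j) > 0 else W $$ (i, j) = 0)"

text \<open>Eigenvalues are listed in decreasing order with their algebraic multiplicities; for a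
  symmetric \<open>n \<times> n\<close> matrix the list has length \<open>n\<close>. The second-largest one is meaningful
  for \<open>n \<ge> 2\<close> only.\<close>

definition eigenvalues_desc :: "real mat \<Rightarrow> real list" where
  "eigenvalues_desc A = rev (sorted_list_of_multiset (proots (char_poly A)))"

definition lambda2 :: "real mat \<Rightarrow> real" where
  "lambda2 A = eigenvalues_desc A ! 1"

definition spectral_gap :: "real mat \<Rightarrow> real" where
  "spectral_gap W = 1 - lambda2 W"

section \<open>Decentralized first-order oracle algorithms\<close>

definition Lin :: "nat \<Rightarrow> real vec set \<Rightarrow> real vec set" where
  "Lin d S = LinearCombinations.module.span class_ring (module_vec TYPE(real) d) S"

text \<open>Time is real, because the cost \<open>\<tau>\<close> of a communication round is an arbitrary positive real;
  \<open>M i s\<close> is the memory of agent \<open>i\<close> at time \<open>s\<close>. There is no memory at negative times, so for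
  \<open>0 < s < 1\<close> local computation yields only \<^term>\<open>Lin d {}\<close>, that is, the zero vector. As the
  zero vector may thus be kept at every time, any computation may be started with a delay, and
  agents can wait for messages although \<open>comp_memory\<close> only looks back by exactly one time unit.\<close>

definition comp_memory ::
  "nat \<Rightarrow> (real vec \<Rightarrow> real) \<Rightarrow> (real \<Rightarrow> real vec set) \<Rightarrow> real \<Rightarrow> real vec set" where
  "comp_memory d f M s =
     Lin d (\<Union>x\<in>(if 1 \<le> s then M (s - 1) else {}). {x, gradient d f x})"

definition comm_memory ::
  "nat \<Rightarrow> (nat \<times> nat) set \<Rightarrow> real \<Rightarrow> (nat \<Rightarrow> real \<Rightarrow> real vec set) \<Rightarrow> nat \<Rightarrow> real \<Rightarrow> real vec set" where
  "comm_memory d E \<tau> M i s =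
     (if \<tau> < s then Lin d (\<Union>j\<in>{j. (i, j) \<in> E}. M j (s - \<tau>)) else {})"

text \<open>A DFO algorithm is represented by its run on \<open>f\<close>: the memories \<open>M\<close> and the local outputs,
  where \<open>out i s = None\<close> means that agent \<open>i\<close> specifies no output at time \<open>s\<close>.\<close>

definition DFO_run ::
  "nat \<Rightarrow> nat \<Rightarrow> (nat \<times> nat) set \<Rightarrow> (nat \<Rightarrow> real vec \<Rightarrow> real) \<Rightarrow> real \<Rightarrow>
   (nat \<Rightarrow> real \<Rightarrow> real vec set) \<Rightarrow> (nat \<Rightarrow> real \<Rightarrow> real vec option) \<Rightarrow> bool" where
  "DFO_run n d E f \<tau> M out \<longleftrightarrow>
     (\<forall>i<n. M i 0 = {0\<^sub>v d}) \<and>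
     (\<forall>i<n. \<forall>s>0. M i s \<subseteq> comp_memory d (f i) (M i) s \<union> comm_memory d E \<tau> M i s) \<and>
     (\<forall>i<n. \<forall>s\<ge>0. \<forall>x. out i s = Some x \<longrightarrow> x \<in> M i s)"

text \<open>The times up to \<open>t\<close> at which a communication is completed, that is, at which some agent
  holds a vector that local computation alone does not explain.\<close>

definition comm_times ::
  "nat \<Rightarrow> nat \<Rightarrow> (nat \<Rightarrow> real vec \<Rightarrow> real) \<Rightarrow> (nat \<Rightarrow> real \<Rightarrow> real vec set) \<Rightarrow> real \<Rightarrow> real set" where
  "comm_times n d f M t =
     {s. 0 < s \<and> s \<le> t \<and> (\<exists>i<n. \<not> M i s \<subseteq> comp_memory d (f i) (M i) s)}"

text \<open>A communication completed at time \<open>s\<close> occupies the time interval from \<open>s - \<tau>\<close> to \<open>s\<close>.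
  Communications of different agents may run in parallel within one round, so the number of rounds
  is the largest number of communications no two of which overlap. It is at most the number
  of communication times, and for \<open>\<tau> > 0\<close> it is a maximum over a bounded set of numbers even when
  there are infinitely many communication times.\<close>

definition comm_rounds ::
  "nat \<Rightarrow> nat \<Rightarrow> (nat \<Rightarrow> real vec \<Rightarrow> real) \<Rightarrow> real \<Rightarrow> (nat \<Rightarrow> real \<Rightarrow> real vec set) \<Rightarrow> real \<Rightarrow> nat" where
  "comm_rounds n d f \<tau> M t =
     Sup {card P | P. finite P \<and> P \<subseteq> comm_times n d f M t \<and>
                      pairwise (\<lambda>s s'. \<tau> \<le> \<bar>s - s'\<bar>) P}"

end

theory Submission
  imports Defs
begin

text \<open>The hard function is a chain of \<open>\<Theta>(\<kappa> log (1/\<epsilon>))\<close> coordinates. In rescaled coordinates \<open>z\<^sub>k\<close> with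
  geometrically decaying weights \<open>u\<^sub>k = A\<^sup>2 q\<^sup>k\<close>, where \<open>1 - q\<close> is of order \<open>1/\<kappa>\<close>, it is the sum of
  the terms \<open>u\<^sub>k ((z\<^sub>k - z\<^sub>k\<^sub>-\<^sub>1)\<^sup>2 / 52 + V z\<^sub>k)\<close> with \<open>z\<^sub>0 = 0\<close>. The potential \<open>V\<close> looks like \<open>z\<^sup>2/2\<close>
  but has a second critical point at \<open>1\<close>, and the origin of \<open>\<real>\<^sup>d\<close> corresponds to \<open>z = 1\<close>. Hence the
  chain can only be unfrozen one coordinate after the other, and as long as the first \<open>K\<close>
  coordinates alone have moved, the tail of weight of order \<open>\<kappa> q\<^sup>K\<close> keeps the value above \<open>\<epsilon>\<close>.
  The function is PL with a constant of order \<open>1 - q\<close>: a maximal run of coordinates near \<open>1\<close> has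
  total weight at most \<open>1/(1 - q)\<close> times the weight of its first member, and the jump into the run
  produces a gradient there.

  The odd links of the chain are given to the agents at one end of a path and the even links to
  those at the other end, so that every new coordinate costs one gradient evaluation and a
  traversal of \<open>\<Theta>(1/\<surd>\<gamma>)\<close> edges. The mixing matrix is \<open>I - c\<close> times the path Laplacian, whose
  eigenvectors are discrete cosines.\<close>

section \<open>The network\<close>

definition path_edges :: "nat \<Rightarrow> (nat \<times> nat) set" where
  "path_edges n = {(i, j). i < n \<and> j < n \<and> (j = Suc i \<or> i = Suc j)}"

lemma connected_path: "connected_network n (path_edges n)"
proof -
  have sym: "sym (path_edges n)" by (auto simp: path_edges_def sym_def)
  have "(0, i) \<in> (path_edges n)\<^sup>*" if "i < n" for i
    using that
  proof (induction i)
    case (Suc i)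
    then have "(i, Suc i) \<in> path_edges n" by (simp add: path_edges_def)
    with Suc show ?case by (simp add: rtrancl.rtrancl_into_rtrancl)
  qed simp
  moreover from this have "(i, 0) \<in> (path_edges n)\<^sup>*" if "i < n" for i
    using that sym by (meson sym_rtrancl symD)
  ultimately show ?thesis
    unfolding connected_network_def using sym
    by (auto simp: path_edges_def irrefl_def intro: rtrancl_trans)
qed

text \<open>The two \<open>of_bool\<close> terms add up to the degree of agent \<open>i\<close> in
  the path.\<close>

definition path_mix :: "nat \<Rightarrow> real \<Rightarrow> real mat" where
  "path_mix n c = mat n n (\<lambda>(i, j).
     if i = j then 1 - c * (of_bool (0 < i) + of_bool (Suc i < n))
     else if j = Suc i \<or> i = Suc j then c else 0)"

lemma path_mix_carrier [simp]: "path_mix n c \<in> carrier_mat n n"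
  and path_mix_dim [simp]: "dim_row (path_mix n c) = n" "dim_col (path_mix n c) = n"
  by (simp_all add: path_mix_def)

lemma transpose_path_mix: "transpose_mat (path_mix n c) = path_mix n c"
  by (rule eq_matI) (auto simp: path_mix_def)

lemma path_mix_mult:
  assumes "i < n"
  shows "(path_mix n c *\<^sub>v vec n v) $ i = v i + c * (if 0 < i then v (i - 1) - v i else 0)
    + c * (if Suc i < n then v (Suc i) - v i else 0)"
proof -
  have "(path_mix n c *\<^sub>v vec n v) $ i = (\<Sum>j<n. path_mix n c $$ (i, j) * v j)"
    using assms by (simp add: scalar_prod_def lessThan_atLeast0)
  also have "\<dots> = (\<Sum>j<n. (if j = i then (1 - c * (of_bool (0 < i) + of_bool (Suc i < n))) * v i else 0)
      + (if j = Suc i then c * v (Suc i) else 0) + (if j = i - 1 then if 0 < i then c * v (i - 1) else 0 else 0))"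
    using assms by (intro sum.cong) (auto simp: path_mix_def)
  also have "\<dots> = (1 - c * (of_bool (0 < i) + of_bool (Suc i < n))) * v i
      + (if Suc i < n then c * v (Suc i) else 0) + (if 0 < i then c * v (i - 1) else 0)"
    using assms by (simp add: sum.distrib)
  finally show ?thesis by (auto simp: algebra_simps)
qed

text \<open>Summation by parts: the two one-sided difference sums combine into minus the Dirichlet
  energy of the path.\<close>

lemma path_mix_form:
  "vec n v \<bullet> (path_mix n c *\<^sub>v vec n v) = (\<Sum>i<n. (v i)\<^sup>2) - c * (\<Sum>i<n - 1. (v (Suc i) - v i)\<^sup>2)"
proof (cases n)
  case (Suc m)
  have "vec n v \<bullet> (path_mix n c *\<^sub>v vec n v) = (\<Sum>i<n. v i * (path_mix n c *\<^sub>v vec n v) $ i)"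
    by (simp add: scalar_prod_def lessThan_atLeast0)
  also have "\<dots> = (\<Sum>i<n. (v i)\<^sup>2 + c * (if 0 < i then v i * (v (i - 1) - v i) else 0)
      + c * (if Suc i < n then v i * (v (Suc i) - v i) else 0))"
    by (intro sum.cong) (auto simp: path_mix_mult power2_eq_square algebra_simps
      simp del: index_mult_mat_vec)
  also have "\<dots> = (\<Sum>i<n. (v i)\<^sup>2) + c * (\<Sum>i<n. if 0 < i then v i * (v (i - 1) - v i) else 0)
      + c * (\<Sum>i<n. if Suc i < n then v i * (v (Suc i) - v i) else 0)"
    by (simp only: sum.distrib sum_distrib_left)
  also have "(\<Sum>i<n. if 0 < i then v i * (v (i - 1) - v i) else 0) = (\<Sum>i<m. v (Suc i) * (v i - v (Suc i)))"
    unfolding Suc by (subst sum.lessThan_Suc_shift) simp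
  also have "(\<Sum>i<n. if Suc i < n then v i * (v (Suc i) - v i) else 0) = (\<Sum>i<m. v i * (v (Suc i) - v i))"
    unfolding Suc by simp
  also have "(\<Sum>i<n. (v i)\<^sup>2) + c * (\<Sum>i<m. v (Suc i) * (v i - v (Suc i))) + c * (\<Sum>i<m. v i * (v (Suc i) - v i))
      = (\<Sum>i<n. (v i)\<^sup>2) - c * (\<Sum>i<m. (v (Suc i) - v i)\<^sup>2)"
  proof -
    have "(\<Sum>i<m. v (Suc i) * (v i - v (Suc i))) + (\<Sum>i<m. v i * (v (Suc i) - v i))
        = - (\<Sum>i<m. (v (Suc i) - v i)\<^sup>2)"
      unfolding sum.distrib[symmetric] sum_negf[symmetric]
      by (intro sum.cong) (auto simp: power2_eq_square algebra_simps)
    then show ?thesis by (simp add: distrib_left[symmetric] add.assoc)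
  qed
  finally show ?thesis by (simp add: Suc)
qed (simp add: scalar_prod_def)

text \<open>The energy is at most 4 times the squared norm, hence the bound 1/4 on \<open>c\<close>.
  With two agents both are end points and the factor drops to 2; the weaker bound 1/2 makes a
  spectral gap of 1 attainable.\<close>

lemma path_mix_mixing_matrix:
  assumes n: "n \<ge> 2" and c: "0 < c" "c \<le> 1/4 \<or> n = 2 \<and> c \<le> 1/2"
  shows "mixing_matrix n (path_edges n) (path_mix n c)"
proof -
  have form: "v \<bullet> (path_mix n c *\<^sub>v v) = (\<Sum>i<n. (v $ i)\<^sup>2) - c * (\<Sum>i<n - 1. (v $ Suc i - v $ i)\<^sup>2)"
    if "v \<in> carrier_vec n" for v
  proof -
    have "vec n (\<lambda>i. v $ i) = v" using that by auto
    then show ?thesis using path_mix_form[of n "\<lambda>i. v $ i" c] by simp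
  qed
  have "psd n (path_mix n c)"
    unfolding psd_def
  proof (intro conjI ballI)
    fix v :: "real vec" assume v: "v \<in> carrier_vec n"
    define S where "S = (\<Sum>i<n. (v $ i)\<^sup>2)"
    obtain m where m: "n = Suc m" using n by (cases n) auto
    have S: "S = (\<Sum>i<m. (v $ i)\<^sup>2) + (v $ m)\<^sup>2" "S = (v $ 0)\<^sup>2 + (\<Sum>i<m. (v $ Suc i)\<^sup>2)"
      unfolding S_def m by (simp, rule sum.lessThan_Suc_shift)
    have "(\<Sum>i<n - 1. (v $ Suc i - v $ i)\<^sup>2) \<le> (\<Sum>i<m. 2 * (v $ Suc i)\<^sup>2 + 2 * (v $ i)\<^sup>2)"
      unfolding m diff_Suc_1
    proof (rule sum_mono)
      fix i show "(v $ Suc i - v $ i)\<^sup>2 \<le> 2 * (v $ Suc i)\<^sup>2 + 2 * (v $ i)\<^sup>2"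
        using zero_le_power2[of "v $ Suc i + v $ i"] by (simp add: power2_eq_square algebra_simps)
    qed
    also have "\<dots> = 2 * (S - (v $ 0)\<^sup>2) + 2 * (S - (v $ m)\<^sup>2)"
      using S by (simp add: sum.distrib sum_distrib_left[symmetric])
    finally have le: "(\<Sum>i<n - 1. (v $ Suc i - v $ i)\<^sup>2) \<le> 4 * S - 2 * (v $ 0)\<^sup>2 - 2 * (v $ m)\<^sup>2" by simp
    have S0: "0 \<le> S" unfolding S_def by (simp add: sum_nonneg)
    have "c * (\<Sum>i<n - 1. (v $ Suc i - v $ i)\<^sup>2) \<le> S"
      using c(2)
    proof
      assume "c \<le> 1/4"
      have "c * (\<Sum>i<n - 1. (v $ Suc i - v $ i)\<^sup>2) \<le> 1/4 * (4 * S)"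
        using \<open>c \<le> 1/4\<close> c(1) le S0 zero_le_power2[of "v $ 0"] zero_le_power2[of "v $ m"]
        by (intro mult_mono) (linarith | auto intro: sum_nonneg)+
      then show ?thesis by simp
    next
      assume "n = 2 \<and> c \<le> 1/2"
      then have "2 * (v $ 0)\<^sup>2 + 2 * (v $ m)\<^sup>2 = 2 * S" using m by (simp add: S_def numeral_2_eq_2)
      then have "(\<Sum>i<n - 1. (v $ Suc i - v $ i)\<^sup>2) \<le> 2 * S" using le by linarith
      then have "c * (\<Sum>i<n - 1. (v $ Suc i - v $ i)\<^sup>2) \<le> 1/2 * (2 * S)"
        using \<open>n = 2 \<and> c \<le> 1/2\<close> c(1) S0 by (intro mult_mono) (auto intro: sum_nonneg)
      then show ?thesis by simp
    qed
    then show "0 \<le> v \<bullet> (path_mix n c *\<^sub>v v)" using form[OF v] by (simp add: S_def)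
  qed (simp_all add: transpose_path_mix)
  moreover have "psd n (1\<^sub>m n - path_mix n c)"
    unfolding psd_def
  proof (intro conjI ballI)
    show "transpose_mat (1\<^sub>m n - path_mix n c) = 1\<^sub>m n - path_mix n c"
      by (rule eq_matI) (auto simp: path_mix_def)
    fix v :: "real vec" assume v: "v \<in> carrier_vec n"
    have "(1\<^sub>m n - path_mix n c) *\<^sub>v v = v - path_mix n c *\<^sub>v v"
      using v by (simp add: minus_mult_distrib_mat_vec[where nr = n and nc = n])
    then have "v \<bullet> ((1\<^sub>m n - path_mix n c) *\<^sub>v v) = v \<bullet> v - v \<bullet> (path_mix n c *\<^sub>v v)"
      using scalar_prod_minus_distrib[OF v v mult_mat_vec_carrier[OF path_mix_carrier v]] by simp
    also have "v \<bullet> v = (\<Sum>i<n. (v $ i)\<^sup>2)"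
      using v by (simp add: scalar_prod_def lessThan_atLeast0 power2_eq_square)
    finally show "0 \<le> v \<bullet> ((1\<^sub>m n - path_mix n c) *\<^sub>v v)"
      using form[OF v] c(1) by (simp add: sum_nonneg)
  qed (simp add: minus_carrier_mat)
  moreover have "path_mix n c *\<^sub>v vec n (\<lambda>_. 1) = vec n (\<lambda>_. 1)"
    by (rule eq_vecI) (simp_all add: path_mix_mult del: index_mult_mat_vec)
  moreover have "if (i, j) \<in> path_edges n \<or> i = j then path_mix n c $$ (i, j) > 0 else path_mix n c $$ (i, j) = 0"
    if "i < n" "j < n" for i j
    using that n c by (auto simp: path_mix_def path_edges_def)
  ultimately show ?thesis by (simp add: mixing_matrix_def transpose_path_mix)
qed

section \<open>The spectrum of the path matrix\<close>

lemma eigenvalues_desc_eqI: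
  assumes A: "A \<in> carrier_mat n n" and xs: "length xs = n" "sorted_wrt (>) xs"
    and ev: "\<And>x. x \<in> set xs \<Longrightarrow> eigenvalue A x"
  shows "eigenvalues_desc A = xs"
proof -
  define p where "p = char_poly A"
  have p: "degree p = n" "p \<noteq> 0" using degree_monic_char_poly[OF A] by (auto simp: p_def)
  have dist: "distinct xs" using xs(2) by (induction xs) auto
  have "mset xs \<subseteq># proots p"
  proof (rule mset_subset_eqI)
    fix x
    show "count (mset xs) x \<le> count (proots p) x"
    proof (cases "x \<in> set xs")
      case True
      then have "poly p x = 0" using ev eigenvalue_root_char_poly[OF A] by (auto simp: p_def)
      then have "0 < count (proots p) x" using p(2) by (simp add: order_gt_0_iff)
      moreover have "count (mset xs) x \<le> 1" using dist by (simp add: distinct_count_atmost_1)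
      ultimately show ?thesis by linarith
    next
      case False
      then have "count (mset xs) x = 0" by (simp add: count_eq_zero_iff)
      then show ?thesis by linarith
    qed
  qed
  moreover have "size (proots p) \<le> size (mset xs)" using size_proots_le[of p] p(1) xs(1) by simp
  \<comment> \<open>The \<open>n\<close> distinct eigenvalues exhaust the at most \<open>n\<close>
    roots, so all roots are simple and the list is complete.\<close>
  ultimately have "proots p = mset xs" using mset_subset_size[of "mset xs" "proots p"]
    by (metis leD subset_mset.le_imp_less_or_eq)
  moreover have "sort xs = rev xs"
  proof (rule properties_for_sort)
    show "sorted (rev xs)" using xs(2) by (simp add: sorted_wrt_rev) (metis (mono_tags, lifting) less_imp_le sorted_wrt_mono_rel)
  qed simp
  ultimately show ?thesis by (simp add: eigenvalues_desc_def p_def)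
qed

text \<open>The shift by 1/2 makes the cosine vector symmetric about both ends of the path: a
  missing neighbour would have the value of the end point itself, so the interior recurrence holds
  in every row.\<close>

lemma path_mix_eigenvalue:
  assumes "k < n"
  shows "eigenvalue (path_mix n c) (1 - c * (2 - 2 * cos (pi * k / n)))"
proof -
  define \<theta> where "\<theta> = pi * k / n"
  define v where "v i = cos (\<theta> * (real i + 1/2))" for i
  have n: "n > 0" using assms by simp
  have "\<theta> * real n = real k * pi" using n by (simp add: \<theta>_def)
  have "path_mix n c *\<^sub>v vec n v = (1 - c * (2 - 2 * cos \<theta>)) \<cdot>\<^sub>v vec n v"
  proof (rule eq_vecI)
    fix i assume "i < dim_vec ((1 - c * (2 - 2 * cos \<theta>)) \<cdot>\<^sub>v vec n v)"
    then have i: "i < n" by simp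
    have l: "(if 0 < i then v (i - 1) - v i else 0) = cos (\<theta> * (real i - 1/2)) - v i"
      by (auto simp: v_def of_nat_diff algebra_simps)
    have r: "(if Suc i < n then v (Suc i) - v i else 0) = cos (\<theta> * (real i + 3/2)) - v i"
    proof (cases "Suc i < n")
      case False
      then have "real n = real i + 1" using i by linarith
      then have "\<theta> * (real i + 3/2) = \<theta> * real n + \<theta> / 2" "\<theta> * (real i + 1/2) = \<theta> * real n - \<theta> / 2"
        by (simp_all only: \<open>real n = real i + 1\<close>) (simp_all add: field_simps)
      with \<open>\<theta> * real n = real k * pi\<close> False show ?thesis by (simp add: v_def cos_add cos_diff)
    qed (simp add: v_def algebra_simps)
    have "cos (\<theta> * (real i - 1/2)) + cos (\<theta> * (real i + 3/2))
        = cos (\<theta> * (real i + 1/2) - \<theta>) + cos (\<theta> * (real i + 1/2) + \<theta>)" by (simp add: algebra_simps)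
    also have "\<dots> = 2 * cos \<theta> * v i" by (simp add: cos_add cos_diff v_def)
    finally have s: "cos (\<theta> * (real i - 1/2)) + cos (\<theta> * (real i + 3/2)) = 2 * cos \<theta> * v i" .
    have "(path_mix n c *\<^sub>v vec n v) $ i = v i + c * (cos (\<theta> * (real i - 1/2)) + cos (\<theta> * (real i + 3/2)) - 2 * v i)"
      unfolding path_mix_mult[OF i] l r by (simp add: algebra_simps)
    then show "(path_mix n c *\<^sub>v vec n v) $ i = ((1 - c * (2 - 2 * cos \<theta>)) \<cdot>\<^sub>v vec n v) $ i"
      unfolding s using i by (simp add: algebra_simps)
  qed simp
  \<comment> \<open>Entry 0 is the cosine of \<open>\<theta> / 2\<close>, positive because
    \<open>k < n\<close> gives \<open>\<theta> < pi\<close>.\<close>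
  moreover have "vec n v \<noteq> 0\<^sub>v n"
  proof
    assume "vec n v = 0\<^sub>v n"
    then have "vec n v $ 0 = 0\<^sub>v n $ 0" by simp
    then have "v 0 = 0" using n by simp
    moreover have "\<theta> / 2 < pi / 2" using assms by (simp add: \<theta>_def field_simps)
    moreover have "- (pi / 2) < \<theta> / 2"
      by (rule less_le_trans[of _ 0]) (simp_all add: \<theta>_def)
    ultimately show False using cos_gt_zero_pi[of "\<theta> / 2"] by (simp add: v_def)
  qed
  ultimately show ?thesis unfolding eigenvalue_def eigenvector_def \<theta>_def
    by (intro exI[of _ "vec n v"]) simp
qed

text \<open>Cosine decreases strictly on the interval from 0 to \<pi>, so the eigenvalues are
  distinct and sorted by \<open>k\<close>; \<open>k = 0\<close> gives 1 and \<open>k = 1\<close> the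
  second-largest.\<close>

lemma spectral_gap_path_mix:
  assumes "n \<ge> 2" "c > 0"
  shows "spectral_gap (path_mix n c) = c * (2 - 2 * cos (pi / n))"
proof -
  define ev where "ev k = 1 - c * (2 - 2 * cos (pi * real k / real n))" for k
  have "eigenvalues_desc (path_mix n c) = map ev [0..<n]"
  proof (rule eigenvalues_desc_eqI)
    show "sorted_wrt (>) (map ev [0..<n])"
      unfolding sorted_wrt_map
    proof (rule sorted_wrt_mono_rel[OF _ sorted_wrt_upt])
      fix k l assume kl: "k \<in> set [0..<n]" "l \<in> set [0..<n]" "k < l"
      then have "pi * real k / real n < pi * real l / real n" "pi * real l / real n \<le> pi"
        by (auto simp: field_simps)
      then have "cos (pi * real l / real n) < cos (pi * real k / real n)"
        by (intro cos_monotone_0_pi) auto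
      then show "ev l < ev k" using assms(2) by (simp add: ev_def)
    qed
  qed (auto simp: ev_def intro: path_mix_eigenvalue)
  then have "lambda2 (path_mix n c) = ev 1" using assms(1) by (simp add: lambda2_def)
  then show ?thesis by (simp add: spectral_gap_def ev_def)
qed

lemma cos_le_quartic:
  assumes "0 < x"
  shows "cos x \<le> 1 - x\<^sup>2 / 2 + x ^ 4 / (24 :: real)"
proof -
  obtain t where "cos x = (\<Sum>m<4. cos_coeff m * x ^ m) + cos (t + 1/2 * real 4 * pi) / fact 4 * x ^ 4"
    using Maclaurin_cos_expansion2[OF assms, of 4] by auto
  moreover have "(\<Sum>m<4. cos_coeff m * x ^ m) = 1 - x\<^sup>2 / 2"
  proof -
    have "(\<Sum>m<4. cos_coeff m * x ^ m)
        = cos_coeff 0 + cos_coeff 1 * x + cos_coeff 2 * x ^ 2 + cos_coeff 3 * x ^ 3"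
      by (simp add: eval_nat_numeral)
    then show ?thesis by (simp add: cos_coeff_def)
  qed
  moreover have "cos (t + 1/2 * real 4 * pi) / fact 4 * x ^ 4 \<le> 1 / fact 4 * x ^ 4"
    by (intro mult_right_mono divide_right_mono) auto
  moreover have "fact 4 = (24 :: real)" by (simp add: numeral_eq_Suc)
  ultimately show ?thesis by simp
qed

text \<open>With \<open>n\<close> of order 1/sqrt \<gamma>, the Laplacian has a gap \<open>D\<close>
  of order at least \<gamma>, and the scaling \<open>c = \<gamma> / D\<close> adjusts the gap of the
  matrix to \<gamma> exactly.\<close>

lemma path_with_spectral_gap:
  assumes \<gamma>: "0 < \<gamma>" "\<gamma> \<le> 1"
  obtains n c where "n \<ge> 2" "mixing_matrix n (path_edges n) (path_mix n c)"
    "spectral_gap (path_mix n c) = \<gamma>" "1 / (4 * sqrt \<gamma>) \<le> real n"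
proof -
  define t where "t = 1 / (2 * sqrt \<gamma>)"
  define n where "n = max 2 (nat \<lfloor>t\<rfloor>)"
  define D where "D = 2 - 2 * cos (pi / n)"
  have t: "t > 0" using \<gamma> by (simp add: t_def)
  have n: "n \<ge> 2" by (simp add: n_def)
  have "cos (pi / n) < cos 0" using n by (intro cos_monotone_0_pi) (auto simp: divide_le_eq)
  then have D: "D > 0" by (simp add: D_def)
  have c: "\<gamma> / D \<le> 1/4 \<or> n = 2 \<and> \<gamma> / D \<le> 1/2"
  proof (cases "n = 2")
    case True
    then have "D = 2" by (simp add: D_def)
    with True \<gamma> show ?thesis by simp
  next
    case False
    then have n3: "n \<ge> 3" "real n \<le> t" using n t by (auto simp: n_def max_def le_nat_floor split: if_splits)
    have "real n * (2 * sqrt \<gamma>) \<le> 1" using n3(2) \<gamma> by (simp add: t_def field_simps)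
    then have "(real n * (2 * sqrt \<gamma>))\<^sup>2 \<le> 1" using \<gamma> by (intro power_le_one) auto
    then have n\<gamma>: "4 * \<gamma> \<le> 1 / (real n)\<^sup>2"
      using \<gamma> n by (simp add: power_mult_distrib field_simps)
    \<comment> \<open>For \<open>n \<ge> 3\<close> the angle is at most 4/3, which keeps the quartic
      correction below a sixth of the quadratic term. Hence \<open>D\<close> is at least 5/6 of the
      square of \<open>x\<close>, which dominates 4\<gamma>.\<close>
    define x where "x = pi / real n"
    have x: "0 < x" "2 / real n \<le> x" "x \<le> 4/3"
    proof -
      show "0 < x" "2 / real n \<le> x" using n pi_ge_two by (auto simp: x_def divide_right_mono)
      have "x \<le> 4 / 3" unfolding x_def using n3 pi_less_4 by (intro frac_le) auto
      then show "x \<le> 4/3" .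
    qed
    have "x\<^sup>2 \<le> (4/3)\<^sup>2" using x by (intro power_mono) auto
    then have "x\<^sup>2 \<le> 2" by (simp add: power2_eq_square)
    then have "x\<^sup>2 * x\<^sup>2 \<le> x\<^sup>2 * 2" by (intro mult_left_mono) auto
    then have "x ^ 4 \<le> 2 * x\<^sup>2" by (simp add: power4_eq_xxxx power2_eq_square algebra_simps)
    then have "D \<ge> 5/6 * x\<^sup>2" using cos_le_quartic[OF x(1)] unfolding D_def x_def[symmetric] by linarith
    moreover have "(2 / real n)\<^sup>2 \<le> x\<^sup>2" using x n by (intro power_mono) auto
    ultimately have "D \<ge> 4 * \<gamma>" using n\<gamma> \<gamma> by (simp add: power_divide)
    then show ?thesis using D by (simp add: field_simps)
  qed
  show ?thesis
  proof (rule that[OF n])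
    show "mixing_matrix n (path_edges n) (path_mix n (\<gamma> / D))"
      using path_mix_mixing_matrix[OF n _ c] \<gamma> D by simp
    show "spectral_gap (path_mix n (\<gamma> / D)) = \<gamma>"
      using spectral_gap_path_mix[OF n, of "\<gamma> / D"] \<gamma> D by (simp add: D_def)
    have "t / 2 \<le> real n"
    proof (cases "t \<le> 4")
      case True
      then show ?thesis using n by linarith
    next
      case False
      then have "t - 1 \<le> real (nat \<lfloor>t\<rfloor>)" by linarith
      moreover have "real (nat \<lfloor>t\<rfloor>) \<le> real n" by (simp add: n_def)
      ultimately show ?thesis using False by linarith
    qed
    then show "1 / (4 * sqrt \<gamma>) \<le> real n" by (simp add: t_def)
  qed
qed

section \<open>Progress of decentralized first-order algorithms\<close>

lemma Lin_carrier: "S \<subseteq> carrier_vec d \<Longrightarrow> Lin d S \<subseteq> carrier_vec d"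
proof -
  interpret vec_space "TYPE(real)" d .
  show "S \<subseteq> carrier_vec d \<Longrightarrow> Lin d S \<subseteq> carrier_vec d"
    unfolding Lin_def using span_is_subset2 by blast
qed

text \<open>Linear combinations create no support, so new coordinates can only come from gradients
  or from neighbours.\<close>

lemma Lin_coordinate:
  assumes "S \<subseteq> carrier_vec d" "x \<in> Lin d S" "j < d" "x $ j \<noteq> 0"
  shows "\<exists>y\<in>S. y $ j \<noteq> 0"
proof -
  interpret vec_space "TYPE(real)" d .
  from assms(2) obtain a A where A: "x = lincomb a A" "finite A" "A \<subseteq> S"
    unfolding Lin_def using in_spanE by blast
  with assms have "x $ j = (\<Sum>y\<in>A. a y * y $ j)" by (simp add: lincomb_index)
  with assms(4) obtain y where "y \<in> A" "y $ j \<noteq> 0" by (metis (no_types, lifting) mult_zero_right sum.neutral)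
  with A show ?thesis by blast
qed

section \<open>Counting communication rounds\<close>

lemma separated_card_le:
  fixes \<tau> t :: real
  assumes "\<tau> > 0" "finite P" "P \<subseteq> {0<..t}" "pairwise (\<lambda>s s'. \<tau> \<le> \<bar>s - s'\<bar>) P"
  shows "card P \<le> nat \<lfloor>t / \<tau>\<rfloor> + 1"
proof -
  have "inj_on (\<lambda>s. nat \<lfloor>s / \<tau>\<rfloor>) P"
  proof (rule inj_onI, rule ccontr)
    fix s s' assume s: "s \<in> P" "s' \<in> P" "nat \<lfloor>s / \<tau>\<rfloor> = nat \<lfloor>s' / \<tau>\<rfloor>" "s \<noteq> s'"
    then have "0 < s" "0 < s'" "\<tau> \<le> \<bar>s - s'\<bar>" using assms by (auto dest: pairwiseD)
    moreover from this have "\<lfloor>s / \<tau>\<rfloor> = \<lfloor>s' / \<tau>\<rfloor>"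
      using s(3) assms(1) by (simp add: eq_nat_nat_iff)
    then have "\<bar>s / \<tau> - s' / \<tau>\<bar> < 1"
      using floor_correct[of "s / \<tau>"] floor_correct[of "s' / \<tau>"] by linarith
    then have "\<bar>s - s'\<bar> < \<tau>"
      using assms(1) by (simp add: diff_divide_distrib[symmetric] abs_divide divide_less_eq)
    ultimately show False by simp
  qed
  moreover have "(\<lambda>s. nat \<lfloor>s / \<tau>\<rfloor>) ` P \<subseteq> {..nat \<lfloor>t / \<tau>\<rfloor>}"
    using assms by (auto intro!: nat_mono floor_mono divide_right_mono)
  ultimately show ?thesis using card_inj_on_le[of _ P "{..nat \<lfloor>t / \<tau>\<rfloor>}"] by simp
qed

text \<open>A supremum of naturals is informative only for a bounded set; separated times fall into
  distinct cells of length \<tau>.\<close>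

lemma comm_rounds_bdd:
  assumes "\<tau> > 0"
  shows "bdd_above {card P | P. finite P \<and> P \<subseteq> comm_times n d f M t \<and> pairwise (\<lambda>s s'. \<tau> \<le> \<bar>s - s'\<bar>) P}"
  by (rule bdd_aboveI[of _ "nat \<lfloor>t / \<tau>\<rfloor> + 1"])
     (use separated_card_le[OF assms, of _ t] in \<open>force simp: comm_times_def\<close>)

lemma comm_rounds_ge:
  assumes "\<tau> > 0" "finite P" "P \<subseteq> comm_times n d f M t" "pairwise (\<lambda>s s'. \<tau> \<le> \<bar>s - s'\<bar>) P"
  shows "card P \<le> comm_rounds n d f \<tau> M t"
  unfolding comm_rounds_def using assms by (intro cSup_upper comm_rounds_bdd) auto

lemma comm_rounds_witness:
  assumes "\<tau> > 0"
  obtains P where "finite P" "P \<subseteq> comm_times n d f M t" "pairwise (\<lambda>s s'. \<tau> \<le> \<bar>s - s'\<bar>) P"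
    "card P = comm_rounds n d f \<tau> M t"
proof -
  let ?S = "{card P | P. finite P \<and> P \<subseteq> comm_times n d f M t \<and> pairwise (\<lambda>s s'. \<tau> \<le> \<bar>s - s'\<bar>) P}"
  have "bdd_above ?S" using assms by (rule comm_rounds_bdd)
  moreover have "?S \<noteq> {}" by (auto intro!: exI[of _ "{}"])
  ultimately have "Sup ?S \<in> ?S" unfolding bdd_above_nat by (metis (lifting) Max_in cSup_eq_Max)
  then show ?thesis using that unfolding comm_rounds_def by force
qed

lemma comm_rounds_mono:
  assumes "\<tau> > 0" "s \<le> t"
  shows "comm_rounds n d f \<tau> M s \<le> comm_rounds n d f \<tau> M t"
proof -
  obtain P where "finite P" "P \<subseteq> comm_times n d f M s" "pairwise (\<lambda>s s'. \<tau> \<le> \<bar>s - s'\<bar>) P"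
    "card P = comm_rounds n d f \<tau> M s" using comm_rounds_witness[OF assms(1)] .
  moreover from this have "P \<subseteq> comm_times n d f M t" using assms(2) by (force simp: comm_times_def)
  ultimately show ?thesis using comm_rounds_ge[OF assms(1)] by metis
qed

text \<open>A communication completed at \<open>s\<close> has distance at least \<tau> from all
  those completed by \<open>s - \<tau>\<close>, so it extends a largest separated family by
  one.\<close>

lemma comm_rounds_Suc:
  assumes "\<tau> > 0" "s \<in> comm_times n d f M s"
  shows "Suc (comm_rounds n d f \<tau> M (s - \<tau>)) \<le> comm_rounds n d f \<tau> M s"
proof -
  obtain P where P: "finite P" "P \<subseteq> comm_times n d f M (s - \<tau>)"
    "pairwise (\<lambda>s s'. \<tau> \<le> \<bar>s - s'\<bar>) P" "card P = comm_rounds n d f \<tau> M (s - \<tau>)"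
    using comm_rounds_witness[OF assms(1)] .
  have *: "p \<le> s - \<tau>" if "p \<in> P" for p using P(2) that by (auto simp: comm_times_def)
  have "card (insert s P) \<le> comm_rounds n d f \<tau> M s"
  proof (rule comm_rounds_ge[OF assms(1)])
    show "insert s P \<subseteq> comm_times n d f M s"
      using assms P(2) by (force simp: comm_times_def)
    show "pairwise (\<lambda>s s'. \<tau> \<le> \<bar>s - s'\<bar>) (insert s P)"
      using P(3) by (fastforce simp: pairwise_insert dest: *)
  qed (use P in auto)
  moreover have "s \<notin> P" using * assms(1) by force
  ultimately show ?thesis using P by simp
qed

text \<open>\<open>\<nu> i j\<close> is the number of rounds that must precede agent
  \<open>i\<close> holding a vector with nonzero coordinate \<open>j\<close>. One hop raises it by
  at most one, and a gradient opens at most the next coordinate without raising it. So each new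
  coordinate is paid for by a unit of computation and each level by a communication.\<close>

lemma DFO_progress:
  assumes run: "DFO_run n d E f \<tau> M out" and \<tau>: "\<tau> > 0"
    and grad_carrier: "\<And>i x. i < n \<Longrightarrow> x \<in> carrier_vec d \<Longrightarrow> gradient d (f i) x \<in> carrier_vec d"
    and nbr: "\<And>i i' j. (i, i') \<in> E \<Longrightarrow> i' < n \<and> \<nu> i j \<le> Suc (\<nu> i' j)"
    and reveal: "\<And>i x j. i < n \<Longrightarrow> x \<in> carrier_vec d \<Longrightarrow> j < d \<Longrightarrow> gradient d (f i) x $ j \<noteq> 0 \<Longrightarrow>
      j = 0 \<and> \<nu> i j = 0 \<or> (\<exists>j'<d. x $ j' \<noteq> 0 \<and> j \<le> Suc j' \<and> \<nu> i j \<le> \<nu> i j')"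
    and "i < n" "s \<ge> 0" "x \<in> M i s"
  shows "x \<in> carrier_vec d \<and> (\<forall>j<d. x $ j \<noteq> 0 \<longrightarrow>
    real (Suc j) + \<tau> * real (\<nu> i j) \<le> s \<and> \<nu> i j \<le> comm_rounds n d f \<tau> M s)"
  using assms(6-)
\<comment> \<open>Time is real, so the induction measures it in units of
  \<open>min 1 \<tau>\<close>; going back over a computation or a communication removes at least one
  unit.\<close>
proof (induction "nat \<lceil>s / min 1 \<tau>\<rceil>" arbitrary: i s x rule: less_induct)
  case less
  have decr: "nat \<lceil>(s - t) / min 1 \<tau>\<rceil> < nat \<lceil>s / min 1 \<tau>\<rceil>" if "min 1 \<tau> \<le> t" "t \<le> s" for t
  proof -
    have m: "min 1 \<tau> > 0" using \<tau> by simp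
    then have "(s - t) / min 1 \<tau> \<le> s / min 1 \<tau> - 1"
      using that by (simp add: field_simps)
    moreover have "0 < s / min 1 \<tau>" using m that by (intro divide_pos_pos) auto
    ultimately show ?thesis by linarith
  qed
  show ?case
  proof (cases "s = 0")
    case True
    with less run have "x = 0\<^sub>v d" by (auto simp: DFO_run_def)
    then show ?thesis by simp
  next
    case False
    \<comment> \<open>The second alternative excludes computation explicitly: this makes
      \<open>s\<close> a communication time.\<close>
    with less run have "x \<in> comp_memory d (f i) (M i) s \<or>
        x \<notin> comp_memory d (f i) (M i) s \<and> x \<in> comm_memory d E \<tau> M i s"
      unfolding DFO_run_def by (smt (verit) UnE in_mono)
    then show ?thesis
    proof
      assume comp: "x \<in> comp_memory d (f i) (M i) s"
      define S where "S = (\<Union>y\<in>(if 1 \<le> s then M i (s - 1) else {}). {y, gradient d (f i) y})"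
      have IH: "y \<in> carrier_vec d \<and> (\<forall>j<d. y $ j \<noteq> 0 \<longrightarrow>
          real (Suc j) + \<tau> * real (\<nu> i j) \<le> s - 1 \<and> \<nu> i j \<le> comm_rounds n d f \<tau> M (s - 1))"
        if "1 \<le> s" "y \<in> M i (s - 1)" for y
        using less.hyps[OF decr[of 1] less.prems(1) _ that(2)] that(1) by simp
      have S: "S \<subseteq> carrier_vec d"
        using IH grad_carrier[OF less.prems(1)] by (auto simp: S_def split: if_splits)
      have x: "x \<in> Lin d S" using comp by (simp add: comp_memory_def S_def)
      have "real (Suc j) + \<tau> * real (\<nu> i j) \<le> s \<and> \<nu> i j \<le> comm_rounds n d f \<tau> M s"
        if j: "j < d" "x $ j \<noteq> 0" for j
      proof -
        obtain y' where "y' \<in> S" "y' $ j \<noteq> 0" using Lin_coordinate[OF S x j] by blast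
        then obtain y where s: "1 \<le> s" and y: "y \<in> M i (s - 1)"
          and y': "y $ j \<noteq> 0 \<or> gradient d (f i) y $ j \<noteq> 0" by (auto simp: S_def split: if_splits)
        note rounds = comm_rounds_mono[OF \<tau>, of "s - 1" s n d f M]
        \<comment> \<open>A coordinate that was already nonzero is the case
          \<open>j' = j\<close>.\<close>
        from y' have "j = 0 \<and> \<nu> i j = 0 \<or> (\<exists>j'<d. y $ j' \<noteq> 0 \<and> j \<le> Suc j' \<and> \<nu> i j \<le> \<nu> i j')"
          using reveal[OF less.prems(1) _ j(1), of y] IH[OF s y] j(1) by (meson le_SucI order_refl)
        then show ?thesis
        proof
          assume "\<exists>j'<d. y $ j' \<noteq> 0 \<and> j \<le> Suc j' \<and> \<nu> i j \<le> \<nu> i j'"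
          then obtain j' where j': "j' < d" "y $ j' \<noteq> 0" "j \<le> Suc j'" "\<nu> i j \<le> \<nu> i j'" by blast
          from IH[OF s y] j' have "real (Suc j') + \<tau> * real (\<nu> i j') \<le> s - 1"
            "\<nu> i j' \<le> comm_rounds n d f \<tau> M (s - 1)" by auto
          moreover have "\<tau> * real (\<nu> i j) \<le> \<tau> * real (\<nu> i j')" using j' \<tau> by simp
          ultimately show ?thesis using j' rounds by linarith
        qed (use s in auto)
      qed
      then show ?thesis using Lin_carrier[OF S] x by blast
    next
      assume comm: "x \<notin> comp_memory d (f i) (M i) s \<and> x \<in> comm_memory d E \<tau> M i s"
      then have s: "\<tau> < s" by (auto simp: comm_memory_def split: if_splits)
      define S where "S = (\<Union>k\<in>{k. (i, k) \<in> E}. M k (s - \<tau>))"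
      have IH: "y \<in> carrier_vec d \<and> (\<forall>j<d. y $ j \<noteq> 0 \<longrightarrow>
          real (Suc j) + \<tau> * real (\<nu> k j) \<le> s - \<tau> \<and> \<nu> k j \<le> comm_rounds n d f \<tau> M (s - \<tau>))"
        if "(i, k) \<in> E" "y \<in> M k (s - \<tau>)" for y k
        using less.hyps[OF decr[of \<tau>] _ _ that(2)] nbr[OF that(1)] s by simp
      have S: "S \<subseteq> carrier_vec d" using IH by (auto simp: S_def)
      have x: "x \<in> Lin d S" using comm s by (simp add: comm_memory_def S_def)
      have "s \<in> comm_times n d f M s" using comm less.prems False by (auto simp: comm_times_def)
      note rounds = comm_rounds_Suc[OF \<tau> this]
      have "real (Suc j) + \<tau> * real (\<nu> i j) \<le> s \<and> \<nu> i j \<le> comm_rounds n d f \<tau> M s"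
        if j: "j < d" "x $ j \<noteq> 0" for j
      proof -
        obtain y k where y: "(i, k) \<in> E" "y \<in> M k (s - \<tau>)" "y $ j \<noteq> 0"
          using Lin_coordinate[OF S x j] by (auto simp: S_def)
        from nbr[OF y(1)] have "real (\<nu> i j) \<le> real (\<nu> k j) + 1"
          by (metis of_nat_Suc of_nat_le_iff add.commute)
        then have "\<tau> * real (\<nu> i j) \<le> \<tau> * real (\<nu> k j) + \<tau>"
          using mult_left_mono[of _ _ \<tau>] \<tau> by (fastforce simp: distrib_left)
        then show ?thesis using IH[OF y(1,2)] y(3) j(1) nbr[OF y(1), of j] rounds by fastforce
      qed
      then show ?thesis using Lin_carrier[OF S] x by blast
    qed
  qed
qed

section \<open>The scalar potential\<close>

text \<open>\<open>dwell z\<close> agrees with \<open>z\<close> up to a dip of width \<open>1/10\<close> around its zero \<open>1\<close>; \<open>well\<close> is the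
  antiderivative that vanishes at \<open>0\<close>.\<close>

definition well :: "real \<Rightarrow> real" where
  "well z = z\<^sup>2 / 2 - ln ((z - 1)\<^sup>2 + 1/100) / 200 - arctan (10 * (z - 1)) / 10
     + ln (101/100) / 200 - arctan 10 / 10"

definition dwell :: "real \<Rightarrow> real" where
  "dwell z = z * (z - 1)\<^sup>2 / ((z - 1)\<^sup>2 + 1/100)"

lemma real_mvt:
  assumes "\<And>x. (f has_real_derivative f' x) (at x)"
  obtains w where "\<bar>w - z\<bar> \<le> \<bar>t\<bar>" "f (z + t) - f z = t * f' w"
proof -
  consider "t = 0" | "t > 0" | "t < 0" by linarith
  then show ?thesis
  proof cases
    case 1
    then show ?thesis using that[of z] by simp
  next
    case 2
    then obtain w where "z < w" "w < z + t" "f (z + t) - f z = (z + t - z) * f' w"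
      using MVT2[of z "z + t" f f'] assms by auto
    then show ?thesis using that[of w] by simp
  next
    case 3
    then obtain w where "z + t < w" "w < z" "f z - f (z + t) = (z - (z + t)) * f' w"
      using MVT2[of "z + t" z f f'] assms by auto
    then show ?thesis using that[of w] 3 by simp
  qed
qed

lemma well_has_derivative: "(well has_real_derivative dwell z) (at z)"
proof -
  have pos: "(z - 1)\<^sup>2 + 1/100 > 0" "1 + (10 * (z - 1))\<^sup>2 > 0"
    by (simp_all add: add_nonneg_pos add_pos_nonneg)
  have eq: "1 + (10 * (z - 1))\<^sup>2 = 100 * ((z - 1)\<^sup>2 + 1/100)"
    by (simp add: power2_eq_square algebra_simps)
  \<comment> \<open>Logarithm and arctangent contribute numerators \<open>z - 1\<close> and
    \<open>1\<close> over a common denominator; their sum \<open>z\<close> leaves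
    \<open>z - z / (100 * ((z - 1)\<^sup>2 + 1/100))\<close>.\<close>
  have dwell: "z - 2 * (z - 1) / ((z - 1)\<^sup>2 + 1/100) / 200 - 10 / (1 + (10 * (z - 1))\<^sup>2) / 10 = dwell z"
    unfolding dwell_def eq using pos(1)
    by (simp add: divide_simps) (simp add: power2_eq_square algebra_simps)
  have "((\<lambda>z. ln ((z - 1)\<^sup>2 + 1/100)) has_real_derivative 2 * (z - 1) / ((z - 1)\<^sup>2 + 1/100)) (at z)"
    using pos(1) by (auto intro!: derivative_eq_intros)
  moreover have "((\<lambda>z. arctan (10 * (z - 1))) has_real_derivative 10 / (1 + (10 * (z - 1))\<^sup>2)) (at z)"
    by (rule derivative_eq_intros refl | simp add: inverse_eq_divide)+
  moreover have "((\<lambda>z. z\<^sup>2 / 2) has_real_derivative z) (at z)"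
    by (auto intro!: derivative_eq_intros)
  ultimately have "(well has_real_derivative z - 2 * (z - 1) / ((z - 1)\<^sup>2 + 1/100) / 200
      - 10 / (1 + (10 * (z - 1))\<^sup>2) / 10 + 0 - 0) (at z)"
    unfolding well_def by (intro DERIV_add DERIV_diff DERIV_const DERIV_cdivide)
  then show ?thesis using dwell by simp
qed

text \<open>The derivative differs from 1 by at most 11: with \<open>s = z - 1\<close> and
  \<open>D = s\<^sup>2 + 1/100\<close>, the arithmetic-geometric mean inequality gives
  \<open>2 * \<bar>s\<bar> \<le> 10 * D\<close>, and \<open>D \<ge> 1/100\<close> absorbs one factor
  of \<open>D\<close> in the denominator.\<close>

lemma dwell_lipschitz: "\<bar>dwell x - dwell y\<bar> \<le> 12 * \<bar>x - y\<bar>"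
proof -
  define d where "d z = 1 - (1/100 * (1/100 - (z - 1)\<^sup>2 - 2 * (z - 1))) / ((z - 1)\<^sup>2 + 1/100)\<^sup>2"
    for z :: real
  have deriv: "(dwell has_real_derivative d z) (at z)" for z
  proof -
    define D where "D = (z - 1)\<^sup>2 + 1/100"
    have D: "D > 0" by (simp add: D_def add_nonneg_pos)
    have "((\<lambda>z. z * (z - 1)\<^sup>2 / ((z - 1)\<^sup>2 + 1/100)) has_real_derivative
        (((z - 1)\<^sup>2 + z * (2 * (z - 1))) * D - z * (z - 1)\<^sup>2 * (2 * (z - 1))) / (D * D)) (at z)"
      using D unfolding D_def by (auto intro!: derivative_eq_intros)
    also have "((z - 1)\<^sup>2 + z * (2 * (z - 1))) * D - z * (z - 1)\<^sup>2 * (2 * (z - 1))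
        = D * D - 1/100 * (1/100 - (z - 1)\<^sup>2 - 2 * (z - 1))"
      by (simp add: D_def power2_eq_square field_simps)
    also have "(D * D - 1/100 * (1/100 - (z - 1)\<^sup>2 - 2 * (z - 1))) / (D * D)
        = 1 - 1/100 * (1/100 - (z - 1)\<^sup>2 - 2 * (z - 1)) / D\<^sup>2"
      using D by (simp only: diff_divide_distrib power2_eq_square) simp
    finally show ?thesis unfolding D_def dwell_def d_def .
  qed
  have bound: "\<bar>d z\<bar> \<le> 12" for z
  proof -
    define s where "s = z - 1"
    define D where "D = s\<^sup>2 + 1/100"
    have D: "D \<ge> 1/100" "D > 0" by (simp_all add: D_def add_nonneg_pos)
    have s: "2 * \<bar>s\<bar> \<le> 10 * D"
      using zero_le_power2[of "10 * \<bar>s\<bar> - 1"] by (simp add: D_def power2_eq_square algebra_simps)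
    have "\<bar>1/100 - s\<^sup>2 - 2 * s\<bar> \<le> 11 * D"
    proof (rule abs_leI)
      have "2 * s \<le> 10 * D" "- (2 * s) \<le> 10 * D" using s abs_ge_self[of s] abs_ge_minus_self[of s] by linarith+
      then show "1/100 - s\<^sup>2 - 2 * s \<le> 11 * D" "- (1/100 - s\<^sup>2 - 2 * s) \<le> 11 * D"
        using zero_le_power2[of s] D_def by linarith+
    qed
    then have "\<bar>1/100 * (1/100 - s\<^sup>2 - 2 * s)\<bar> \<le> 1/100 * (11 * D)"
      unfolding abs_mult by (intro mult_mono) auto
    also have "\<dots> \<le> 11 * D\<^sup>2" using D by (simp add: power2_eq_square)
    finally have "\<bar>(1/100 * (1/100 - s\<^sup>2 - 2 * s)) / D\<^sup>2\<bar> \<le> 11"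
      using D(2) unfolding abs_divide by (simp add: divide_le_eq)
    then show ?thesis unfolding s_def D_def d_def by linarith
  qed
  obtain w where "dwell (y + (x - y)) - dwell y = (x - y) * d w"
    using real_mvt[of dwell d y "x - y", OF deriv] .
  then have "\<bar>dwell x - dwell y\<bar> = \<bar>d w\<bar> * \<bar>x - y\<bar>" by (simp add: abs_mult)
  then show ?thesis using mult_right_mono[OF bound[of w], of "\<bar>x - y\<bar>"] by simp
qed

lemma well_taylor: "\<bar>well (z + t) - well z - dwell z * t\<bar> \<le> 12 * t\<^sup>2"
proof -
  obtain w where w: "\<bar>w - z\<bar> \<le> \<bar>t\<bar>" "well (z + t) - well z = t * dwell w"
    using real_mvt[of well dwell] well_has_derivative by blast
  have "\<bar>well (z + t) - well z - dwell z * t\<bar> = \<bar>t\<bar> * \<bar>dwell w - dwell z\<bar>"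
    by (simp only: w(2) abs_mult[symmetric]) (simp add: algebra_simps)
  also have "\<dots> \<le> \<bar>t\<bar> * (12 * \<bar>t\<bar>)"
    using dwell_lipschitz[of w z] w(1) by (intro mult_left_mono) auto
  finally show ?thesis by (simp add: power2_eq_square algebra_simps)
qed

lemma well_0 [simp]: "well 0 = 0" by (simp add: well_def arctan_minus)

lemma dwell_1 [simp]: "dwell 1 = 0" by (simp add: dwell_def)

lemma dwell_bounds:
  "0 \<le> z \<Longrightarrow> 0 \<le> dwell z \<and> dwell z \<le> z" "z \<le> 0 \<Longrightarrow> z \<le> dwell z \<and> dwell z \<le> 0"
proof -
  define t where "t = (z - 1)\<^sup>2 / ((z - 1)\<^sup>2 + 1/100)"
  have t: "0 \<le> t" "t \<le> 1" by (auto simp: t_def divide_le_eq add_nonneg_pos)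
  have "dwell z = z * t" by (simp add: t_def dwell_def)
  with t show "0 \<le> z \<Longrightarrow> 0 \<le> dwell z \<and> dwell z \<le> z" "z \<le> 0 \<Longrightarrow> z \<le> dwell z \<and> dwell z \<le> 0"
    using mult_left_mono[of t 1 z] mult_left_mono_neg[of t 1 z]
    by (auto simp: mult_nonpos_nonneg)
qed

text \<open>Outside the dip the factor of \<open>z\<close> in \<open>dwell z\<close> is at least
  1/2, and \<open>t * z\<close> has the sign of \<open>z\<close>, so it cannot cancel it.\<close>

lemma dwell_away:
  assumes "\<bar>z - 1\<bar> \<ge> 1/10" "t \<ge> 0"
  shows "\<bar>z\<bar> / 2 \<le> \<bar>dwell z + t * z\<bar>"
proof -
  define s where "s = (z - 1)\<^sup>2 / ((z - 1)\<^sup>2 + 1/100)"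
  have "(1/10)\<^sup>2 \<le> (z - 1)\<^sup>2" using assms(1) by (subst abs_le_square_iff[symmetric]) auto
  then have "1/2 \<le> s" by (simp add: s_def le_divide_eq add_nonneg_pos power2_eq_square)
  then have "\<bar>z\<bar> * (1/2) \<le> \<bar>z\<bar> * (s + t)" using assms by (intro mult_left_mono) auto
  also have "\<dots> = \<bar>z * (s + t)\<bar>"
    using \<open>1/2 \<le> s\<close> assms(2) by (simp add: abs_mult)
  also have "z * (s + t) = dwell z + t * z"
    by (simp add: dwell_def s_def algebra_simps)
  finally show ?thesis by simp
qed

lemma well_bounds: "0 \<le> well z" "well z \<le> z\<^sup>2 / 2"
proof -
  have d: "((\<lambda>z. well z - z\<^sup>2 / 2) has_real_derivative dwell z - z) (at z)" for z
    by (auto intro!: derivative_eq_intros well_has_derivative)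
  have "0 \<le> well z \<and> well z \<le> z\<^sup>2 / 2"
  proof (cases "0 \<le> z")
    case True
    have "well 0 \<le> well z"
      by (rule DERIV_nonneg_imp_nondecreasing[OF True]) (use well_has_derivative dwell_bounds in blast)
    moreover have "well z - z\<^sup>2 / 2 \<le> well 0 - 0\<^sup>2 / 2"
      by (rule DERIV_nonpos_imp_nonincreasing[OF True]) (use d dwell_bounds in force)
    ultimately show ?thesis by simp
  next
    case False
    then have z: "z \<le> 0" by simp
    have "well 0 \<le> well z"
      by (rule DERIV_nonpos_imp_nonincreasing[OF z]) (use well_has_derivative dwell_bounds in blast)
    moreover have "well z - z\<^sup>2 / 2 \<le> well 0 - 0\<^sup>2 / 2"
      by (rule DERIV_nonneg_imp_nondecreasing[OF z]) (use d dwell_bounds in force)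
    ultimately show ?thesis by simp
  qed
  then show "0 \<le> well z" "well z \<le> z\<^sup>2 / 2" by auto
qed

text \<open>The cost of a coordinate frozen at 1. The arctangent is at most 2 and costs at most 1/5;
  the two logarithms together contribute a nonnegative amount.\<close>

lemma well_1: "well 1 \<ge> 3/10"
proof -
  have "arctan 10 \<le> 2" using arctan_ubound[of 10] pi_less_4 by linarith
  moreover have "ln (1/100 :: real) \<le> ln (101/100)" by simp
  moreover have "well 1 = 1/2 - ln (1/100) / 200 + ln (101/100) / 200 - arctan 10 / 10"
    by (simp add: well_def)
  ultimately show ?thesis by linarith
qed

section \<open>The Polyak--Lojasiewicz inequality along a chain\<close>

text \<open>Charges each index of \<open>A\<close> to its own index of \<open>B\<close>; this moves
  sums over neighbours of far or start indices to sums over classes of indices.\<close>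

lemma sum_shift_le:
  fixes h :: "nat \<Rightarrow> real"
  assumes "finite A" "finite B" "inj_on \<sigma> A" "\<sigma> ` A \<subseteq> B"
    and "\<And>k. k \<in> A \<Longrightarrow> f k \<le> h (\<sigma> k)" and "\<And>k. k \<in> B \<Longrightarrow> 0 \<le> h k"
  shows "sum f A \<le> sum h B"
proof -
  have "sum f A \<le> (\<Sum>k\<in>A. h (\<sigma> k))" using assms(5) by (rule sum_mono)
  also have "\<dots> = sum h (\<sigma> ` A)" using assms(3) by (simp add: sum.reindex)
  also have "\<dots> \<le> sum h B" using assms by (intro sum_mono2) auto
  finally show ?thesis .
qed

lemma sum_Un3_le:
  fixes h :: "nat \<Rightarrow> real"
  assumes "finite A" "finite B" "finite C" "\<And>k. 0 \<le> h k"
  shows "sum h (A \<union> B \<union> C) \<le> sum h A + sum h B + sum h C"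
proof -
  have "sum h (X \<union> Y) \<le> sum h X + sum h Y" if "finite X" "finite Y" for X Y
    using sum.union_inter[OF that, of h] sum_nonneg[of "X \<inter> Y" h] assms(4) by simp
  from this[of "A \<union> B" C] this[of A B] assms show ?thesis by simp
qed

lemma sq_sum3_le: "(a + b + c)\<^sup>2 \<le> 3 * (a\<^sup>2 + b\<^sup>2 + (c :: real)\<^sup>2)"
proof -
  have "3 * (a\<^sup>2 + b\<^sup>2 + c\<^sup>2) - (a + b + c)\<^sup>2 = (a - b)\<^sup>2 + (b - c)\<^sup>2 + (a - c)\<^sup>2"
    by (simp add: power2_eq_square algebra_simps)
  then show ?thesis
    using zero_le_power2[of "a - b"] zero_le_power2[of "b - c"] zero_le_power2[of "a - c"] by linarith
qed

lemma sq_sum2_le: "(a + b)\<^sup>2 \<le> 2 * (a\<^sup>2 + (b :: real)\<^sup>2)"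
proof -
  have "2 * (a\<^sup>2 + b\<^sup>2) - (a + b)\<^sup>2 = (a - b)\<^sup>2"
    by (simp add: power2_eq_square algebra_simps)
  then show ?thesis using zero_le_power2[of "a - b"] by linarith
qed

text \<open>The chain without vectors: \<open>z\<close> are the rescaled coordinates and
  \<open>u\<close> their weights. \<open>z_end\<close> makes the link beyond \<open>N\<close>
  vanish, and \<open>q \<ge> 3/4\<close> limits the loss of weight under a forward shift to a factor
  4/3.\<close>

locale geometric_chain =
  fixes N :: nat and q :: real and u z :: "nat \<Rightarrow> real"
  assumes q: "3/4 \<le> q" "q < 1" and u_pos: "u k > 0" and u_Suc: "u (Suc k) = q * u k"
    and z_0: "z 0 = 0" and z_end: "z (Suc N) = z N"
begin

text \<open>For \<open>k\<close> from 1 to \<open>N\<close>, the partial derivative in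
  \<open>z k\<close> of the weighted chain sum, divided by \<open>u k\<close>; the factor
  \<open>q\<close> is the ratio of consecutive weights.\<close>

definition G :: "nat \<Rightarrow> real" where
  "G k = dwell (z k) + (z k - z (k - 1)) / 26 - q * (z (Suc k) - z k) / 26"

text \<open>In the dip the potential may exert no force, so near coordinates are not controlled by
  their own gradient entry. Index 0 is never near, so every maximal run has its first index in
  \<open>starts\<close>.\<close>

definition near :: "nat set" where "near = {k \<in> {1..N}. \<bar>z k - 1\<bar> < 1/10}"
definition far :: "nat set" where "far = {1..N} - near"
definition starts :: "nat set" where "starts = {k \<in> near. k - 1 \<notin> near}"
definition ends :: "nat set" where "ends = {k \<in> near. Suc k \<notin> near}"

lemma finite_sets [simp]: "finite near" "finite far" "finite starts" "finite ends"
  by (simp_all add: near_def far_def starts_def ends_def)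

lemma u_decr: "u (Suc k) \<le> u k" using u_Suc[of k] u_pos[of k] q by (simp add: mult_left_le_one_le)

lemma u_incr: "u k \<le> 4/3 * u (Suc k)"
  using u_Suc[of k] mult_right_mono[of "3/4" q "u k"] q u_pos[of k] by simp

lemma u_pred: "1 \<le> k \<Longrightarrow> u k \<le> u (k - 1)"
  using u_decr[of "k - 1"] by simp

text \<open>A shift by one maps each run without its last index onto the run without its first and
  multiplies the weights by \<open>q\<close>. Comparing sums gives
  \<open>(1 - q) * sum u near + q * sum u ends = sum u starts\<close>, from which both bounds
  follow.\<close>

lemma runs:
  "(1 - q) * sum u near \<le> sum u starts" "sum u ends \<le> 4/3 * sum u starts"
proof -
  have "Suc ` (near - ends) = near - starts"
  proof (intro equalityI subsetI)
    fix k assume "k \<in> near - starts"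
    then have "k - 1 \<in> near" "k \<in> near" by (auto simp: starts_def)
    moreover from this have "k = Suc (k - 1)" by (auto simp: near_def)
    ultimately show "k \<in> Suc ` (near - ends)"
      by (intro image_eqI[of _ _ "k - 1"]) (auto simp: ends_def)
  qed (auto simp: starts_def ends_def)
  then have "sum u (near - starts) = (\<Sum>k\<in>near - ends. u (Suc k))"
    by (metis (no_types, lifting) comp_apply inj_Suc inj_on_subset subset_UNIV sum.cong sum.reindex)
  also have "\<dots> = q * sum u (near - ends)" by (simp add: u_Suc sum_distrib_left)
  finally have "sum u near - sum u starts = q * (sum u near - sum u ends)"
    by (simp add: sum_diff starts_def ends_def)
  then have *: "(1 - q) * sum u near + q * sum u ends = sum u starts"
    by (simp add: algebra_simps)
  have nn: "0 \<le> sum u near" "0 \<le> sum u ends" by (auto intro!: sum_nonneg less_imp_le[OF u_pos])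
  then show "(1 - q) * sum u near \<le> sum u starts" using * mult_nonneg_nonneg[of q "sum u ends"] q by linarith
  have "3/4 * sum u ends \<le> q * sum u ends" using nn q by (intro mult_right_mono) auto
  moreover have "0 \<le> (1 - q) * sum u near" using nn q by simp
  ultimately show "sum u ends \<le> 4/3 * sum u starts" using * by linarith
qed

lemma far_z: "k \<in> far \<Longrightarrow> \<bar>z k - 1\<bar> \<ge> 1/10" by (auto simp: far_def near_def)

lemma near_z: "k \<in> near \<Longrightarrow> (z k)\<^sup>2 \<le> 121/100"
proof -
  assume "k \<in> near"
  then have "\<bar>z k - 1\<bar> < 1/10" by (simp add: near_def)
  then have "\<bar>z k\<bar> \<le> 11/10" unfolding abs_less_iff abs_le_iff by linarith
  from power_mono[OF this, of 2] show ?thesis by (simp add: power2_eq_square)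
qed

text \<open>The argument closes a loop: \<Gamma> and \<open>R\<close> are bounded by each other and
  by \<open>G2\<close>, which up to scaling is the squared gradient norm.\<close>

definition \<Gamma> :: real where "\<Gamma> = (\<Sum>k\<in>far. u k * (z k)\<^sup>2)"
definition R :: real where "R = sum u starts"
definition G2 :: real where "G2 = (\<Sum>k=1..N. u k * (G k)\<^sup>2)"

lemma G2_subset: "A \<subseteq> {1..N} \<Longrightarrow> (\<Sum>k\<in>A. u k * (G k)\<^sup>2) \<le> G2"
  unfolding G2_def by (intro sum_mono2) (auto intro!: mult_nonneg_nonneg intro: less_imp_le[OF u_pos])

text \<open>Solving \<open>G k\<close> for the terms in \<open>z k\<close> leaves small multiples of
  the two neighbours, while off the dip those terms amount to at least half of
  \<open>\<bar>z k\<bar>\<close>.\<close>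

lemma far_pointwise:
  assumes "k \<in> far"
  shows "(z k)\<^sup>2 \<le> 12 * (G k)\<^sup>2 + 12/676 * (z (k - 1))\<^sup>2 + 12/676 * (z (Suc k))\<^sup>2"
proof -
  define a where "a = dwell (z k) + (1 + q) / 26 * z k"
  have "\<bar>z k\<bar> / 2 \<le> \<bar>a\<bar>" unfolding a_def using far_z[OF assms] q by (intro dwell_away) auto
  from power_mono[OF this, of 2] have "(z k)\<^sup>2 \<le> 4 * a\<^sup>2" by (simp add: power_divide)
  also have "a = G k + z (k - 1) / 26 + q * z (Suc k) / 26"
    by (simp add: a_def G_def field_simps)
  also have "(G k + z (k - 1) / 26 + q * z (Suc k) / 26)\<^sup>2
      \<le> 3 * ((G k)\<^sup>2 + (z (k - 1) / 26)\<^sup>2 + (q * z (Suc k) / 26)\<^sup>2)" by (rule sq_sum3_le)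
  also have "(q * z (Suc k) / 26)\<^sup>2 \<le> (z (Suc k) / 26)\<^sup>2"
    using q by (simp add: power_divide power_mult_distrib mult_left_le_one_le power_le_one)
  finally show ?thesis by (simp add: power_divide)
qed

text \<open>A neighbour of a far index is far, the end or start of a run, or at the boundary. The
  factor 12/676 is small enough to absorb the far neighbours on the left; they and the right
  boundary count \<open>1 + 1 + 4/3 = 10/3\<close> times.\<close>

lemma far_bound: "636 * \<Gamma> \<le> 8112 * G2 + 39 * R"
proof -
  define h where "h k = (if k = 0 then 0 else u k * (z k)\<^sup>2)" for k
  have h0: "0 \<le> h k" for k by (simp add: h_def less_imp_le u_pos)
  have h_far: "sum h far = \<Gamma>" unfolding \<Gamma>_def by (intro sum.cong) (auto simp: h_def far_def)
  have h_near: "sum h A \<le> 121/100 * sum u A" if "A \<subseteq> near" for A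
    unfolding sum_distrib_left
  proof (rule sum_mono)
    fix k assume "k \<in> A"
    with that near_z[of k] u_pos[of k] show "h k \<le> 121/100 * u k"
      by (auto simp: h_def near_def mult.commute intro!: mult_left_mono)
  qed
  have sub: "starts \<subseteq> near" "ends \<subseteq> near" by (auto simp: starts_def ends_def)
  have "(\<Sum>k\<in>far. u k * (z (k - 1))\<^sup>2) \<le> sum h ({0} \<union> far \<union> ends)"
  proof (rule sum_shift_le[where \<sigma> = "\<lambda>k. k - 1"])
    show "inj_on (\<lambda>k. k - 1) far" by (rule inj_onI) (auto simp: far_def)
    show "(\<lambda>k. k - 1) ` far \<subseteq> {0} \<union> far \<union> ends" by (auto simp: far_def ends_def near_def)
    fix k assume "k \<in> far"
    then have "1 \<le> k" by (auto simp: far_def)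
    then show "u k * (z (k - 1))\<^sup>2 \<le> h (k - 1)"
      using u_pred[of k] z_0 by (auto simp: h_def intro!: mult_right_mono)
  qed (use h0 in auto)
  also have "\<dots> \<le> sum h {0} + sum h far + sum h ends"
    using h0 by (intro sum_Un3_le) auto
  also have "\<dots> \<le> \<Gamma> + 121/100 * (4/3 * R)"
    using h_near[OF sub(2)] h_far runs(2) by (simp add: h_def R_def)
  finally have 1: "(\<Sum>k\<in>far. u k * (z (k - 1))\<^sup>2) \<le> \<Gamma> + 121/100 * (4/3 * R)" .
  \<comment> \<open>The forward shift costs 4/3 in weight; the artificial index \<open>Suc N\<close>
    repeats the term of \<open>N\<close>, because the chain is continued as a constant.\<close>
  define h' where "h' k = (if k = Suc N then u N * (z N)\<^sup>2 else 4/3 * h k)" for k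
  have h'0: "0 \<le> h' k" for k using h0 by (simp add: h'_def less_imp_le u_pos)
  have h'_eq: "sum h' A = 4/3 * sum h A" if "A \<subseteq> {1..N}" for A
    unfolding sum_distrib_left using that by (intro sum.cong) (auto simp: h'_def)
  have "(\<Sum>k\<in>far. u k * (z (Suc k))\<^sup>2) \<le> sum h' ((if N \<in> far then {Suc N} else {}) \<union> far \<union> starts)"
  proof (rule sum_shift_le[where \<sigma> = Suc])
    show "Suc ` far \<subseteq> (if N \<in> far then {Suc N} else {}) \<union> far \<union> starts"
    proof
      fix j assume "j \<in> Suc ` far"
      then obtain k where k: "k \<in> far" "j = Suc k" by auto
      then show "j \<in> (if N \<in> far then {Suc N} else {}) \<union> far \<union> starts"
        by (cases "k = N") (auto simp: far_def starts_def)
    qed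
    fix k assume "k \<in> far"
    then show "u k * (z (Suc k))\<^sup>2 \<le> h' (Suc k)"
      using u_incr[of k] mult_right_mono[of "u k" "4/3 * u (Suc k)" "(z (Suc k))\<^sup>2"] z_end
      by (auto simp: h'_def h_def)
  qed (use h'0 in auto)
  also have "\<dots> \<le> sum h' (if N \<in> far then {Suc N} else {}) + sum h' far + sum h' starts"
    using h'0 by (intro sum_Un3_le) auto
  also have "sum h' (if N \<in> far then {Suc N} else {}) \<le> \<Gamma>"
  proof (cases "N \<in> far")
    case True
    have "u N * (z N)\<^sup>2 \<le> \<Gamma>" unfolding \<Gamma>_def
      using True by (intro member_le_sum) (auto intro!: mult_nonneg_nonneg less_imp_le[OF u_pos])
    with True show ?thesis by (simp add: h'_def)
  qed (auto simp: \<Gamma>_def intro!: sum_nonneg mult_nonneg_nonneg less_imp_le[OF u_pos])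
  also have "sum h' far = 4/3 * \<Gamma>" using h_far by (subst h'_eq) (auto simp: far_def)
  also have "sum h' starts = 4/3 * sum h starts" by (subst h'_eq) (auto simp: starts_def near_def)
  also have "sum h starts \<le> 121/100 * R" using h_near[OF sub(1)] by (simp add: R_def)
  finally have 2: "(\<Sum>k\<in>far. u k * (z (Suc k))\<^sup>2) \<le> \<Gamma> + 4/3 * \<Gamma> + 4/3 * (121/100 * R)" by simp
  have "\<Gamma> \<le> (\<Sum>k\<in>far. 12 * (u k * (G k)\<^sup>2) + 12/676 * (u k * (z (k - 1))\<^sup>2)
      + 12/676 * (u k * (z (Suc k))\<^sup>2))"
    unfolding \<Gamma>_def
  proof (rule sum_mono)
    fix k assume "k \<in> far"
    from mult_left_mono[OF far_pointwise[OF this] less_imp_le[OF u_pos[of k]]]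
    show "u k * (z k)\<^sup>2 \<le> 12 * (u k * (G k)\<^sup>2) + 12/676 * (u k * (z (k - 1))\<^sup>2)
        + 12/676 * (u k * (z (Suc k))\<^sup>2)" by (simp add: algebra_simps)
  qed
  also have "\<dots> = 12 * (\<Sum>k\<in>far. u k * (G k)\<^sup>2) + 12/676 * (\<Sum>k\<in>far. u k * (z (k - 1))\<^sup>2)
      + 12/676 * (\<Sum>k\<in>far. u k * (z (Suc k))\<^sup>2)"
    by (simp only: sum.distrib sum_distrib_left)
  also have "\<dots> \<le> 12 * G2 + 12/676 * (\<Gamma> + 121/100 * (4/3 * R))
      + 12/676 * (\<Gamma> + 4/3 * \<Gamma> + 4/3 * (121/100 * R))"
    using 1 2 G2_subset[of far] by (intro add_mono mult_left_mono) (auto simp: far_def)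
  finally have "\<Gamma> \<le> 12 * G2 + 12/676 * (10/3 * \<Gamma> + 242/75 * R)" by (simp add: field_simps)
  then have "636 * \<Gamma> \<le> 8112 * G2 + 968/25 * R" by (simp add: field_simps)
  moreover have "0 \<le> R" unfolding R_def by (auto intro!: sum_nonneg less_imp_le[OF u_pos])
  ultimately show ?thesis by linarith
qed

text \<open>A run of near indices is entered by a jump: either a neighbour of its first index is
  large enough to pay for that index, or the chain term alone makes \<open>G\<close> large there.\<close>

lemma start_pointwise:
  assumes "k \<in> starts" "\<not> (k - 1 \<in> far \<and> z (k - 1) \<ge> 2/5)" "Suc k \<notin> far \<or> z (Suc k) \<le> 9/10"
  shows "1 \<le> 7600 * (G k)\<^sup>2"
proof -
  have k: "k \<in> near" "1 \<le> k" "k \<le> N" "k - 1 \<notin> near" using assms(1) by (auto simp: starts_def near_def)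
  then have "\<bar>z k - 1\<bar> < 1/10" by (auto simp: near_def)
  then have zk: "9/10 < z k" "z k < 11/10" unfolding abs_less_iff by linarith+
  have "z (k - 1) \<le> 2/5"
  proof (cases "k = 1")
    case False
    with k have "k - 1 \<in> far" by (auto simp: far_def)
    with assms(2) show ?thesis by auto
  qed (simp add: z_0)
  have "z (Suc k) \<le> 11/10"
    using assms(3)
  proof
    assume "Suc k \<notin> far"
    show ?thesis
    proof (cases "k = N")
      case True
      then have "z (Suc k) = z k" using z_end by simp
      then show ?thesis using zk by linarith
    next
      case False
      with k \<open>Suc k \<notin> far\<close> have "Suc k \<in> near" by (auto simp: far_def)
      then have "\<bar>z (Suc k) - 1\<bar> < 1/10" by (auto simp: near_def)
      then show ?thesis unfolding abs_less_iff by linarith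
    qed
  qed simp
  define e j where "e = q * (z (Suc k) - z k)" and "j = z k - z (k - 1)"
  have "q * (z (Suc k) - z k) \<le> 1/5"
  proof (cases "z (Suc k) - z k \<le> 0")
    case True
    then show ?thesis using q mult_nonneg_nonpos[of q "z (Suc k) - z k"] by linarith
  next
    case False
    then have "q * (z (Suc k) - z k) \<le> z (Suc k) - z k"
      using q by (intro mult_left_le_one_le) auto
    with zk \<open>z (Suc k) \<le> 11/10\<close> show ?thesis by linarith
  qed
  then have "e \<le> 1/5" by (simp add: e_def)
  moreover have "1/2 \<le> j" using \<open>z (k - 1) \<le> 2/5\<close> zk unfolding j_def by linarith
  moreover have "0 \<le> dwell (z k)" using dwell_bounds(1)[of "z k"] zk by linarith
  moreover have "G k = dwell (z k) + j / 26 - e / 26" by (simp add: G_def e_def j_def)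
  \<comment> \<open>The incoming jump of at least 1/2 beats the outgoing 1/5, leaving 3/10 divided
    by 26; the square of 260/3 is below 7600.\<close>
  ultimately have "3/260 \<le> G k" by linarith
  from power_mono[OF this, of 2] show ?thesis by (simp add: power2_eq_square)
qed

text \<open>Each start is charged to a large far predecessor (factor 25/4), to a large far successor
  (7/4 exceeds 4/3 times 100/81) or to its own gradient entry; 25/4 and 7/4 add up to 8.\<close>

lemma start_bound: "R \<le> 7600 * G2 + 8 * \<Gamma>"
proof -
  define S1 where "S1 = {k \<in> starts. k - 1 \<in> far \<and> z (k - 1) \<ge> 2/5}"
  define S2 where "S2 = {k \<in> starts. Suc k \<in> far \<and> z (Suc k) > 9/10}"
  have sub: "starts \<subseteq> {1..N}" by (auto simp: starts_def near_def)
  have G0: "0 \<le> u k * (z k)\<^sup>2" for k by (simp add: less_imp_le u_pos)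
  have "sum u S1 \<le> (\<Sum>k\<in>far. 25/4 * (u k * (z k)\<^sup>2))"
  proof (rule sum_shift_le[where \<sigma> = "\<lambda>k. k - 1"])
    have "1 \<le> k" if "k \<in> S1" for k using sub that by (auto simp: S1_def)
    then show "inj_on (\<lambda>k. k - 1) S1" by (intro inj_onI) (metis le_add_diff_inverse)
    fix k assume k: "k \<in> S1"
    then have "(2/5)\<^sup>2 \<le> (z (k - 1))\<^sup>2" by (intro power_mono) (auto simp: S1_def)
    then have "u (k - 1) * (4/25) \<le> u (k - 1) * (z (k - 1))\<^sup>2"
      using u_pos[of "k - 1"] by (intro mult_left_mono) (auto simp: power2_eq_square)
    moreover have "1 \<le> k" using k sub by (auto simp: S1_def)
    ultimately show "u k \<le> 25/4 * (u (k - 1) * (z (k - 1))\<^sup>2)" using u_pred[of k] by simp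
  qed (use G0 in \<open>auto simp: S1_def\<close>)
  then have 1: "sum u S1 \<le> 25/4 * \<Gamma>" by (simp add: \<Gamma>_def sum_distrib_left)
  have "sum u S2 \<le> (\<Sum>k\<in>far. 7/4 * (u k * (z k)\<^sup>2))"
  proof (rule sum_shift_le[where \<sigma> = Suc])
    fix k assume k: "k \<in> S2"
    then have "(9/10)\<^sup>2 \<le> (z (Suc k))\<^sup>2" by (intro power_mono) (auto simp: S2_def)
    then have "u (Suc k) * (81/100) \<le> u (Suc k) * (z (Suc k))\<^sup>2"
      using u_pos[of "Suc k"] by (intro mult_left_mono) (auto simp: power2_eq_square)
    then show "u k \<le> 7/4 * (u (Suc k) * (z (Suc k))\<^sup>2)" using u_incr[of k] u_pos[of "Suc k"] by linarith
  qed (use G0 in \<open>auto simp: S2_def\<close>)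
  then have 2: "sum u S2 \<le> 7/4 * \<Gamma>" by (simp add: \<Gamma>_def sum_distrib_left)
  have "sum u (starts - S1 - S2) \<le> (\<Sum>k\<in>starts - S1 - S2. 7600 * (u k * (G k)\<^sup>2))"
  proof (rule sum_mono)
    fix k assume "k \<in> starts - S1 - S2"
    then have "1 \<le> 7600 * (G k)\<^sup>2" by (intro start_pointwise) (auto simp: S1_def S2_def)
    from mult_left_mono[OF this less_imp_le[OF u_pos[of k]]]
    show "u k \<le> 7600 * (u k * (G k)\<^sup>2)" by (simp add: algebra_simps)
  qed
  also have "\<dots> \<le> 7600 * G2"
    unfolding sum_distrib_left[symmetric] using sub by (intro mult_left_mono G2_subset) auto
  finally have 3: "sum u (starts - S1 - S2) \<le> 7600 * G2" .
  have "R = sum u (S1 \<union> S2 \<union> (starts - S1 - S2))"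
    unfolding R_def by (intro arg_cong[where f = "sum u"]) (auto simp: S1_def S2_def)
  also have "\<dots> \<le> sum u S1 + sum u S2 + sum u (starts - S1 - S2)"
    by (intro sum_Un3_le)
       (auto simp: S1_def S2_def less_imp_le u_pos)
  finally show ?thesis using 1 2 3 by linarith
qed

text \<open>The value is at most a multiple of the weighted sum \<open>Z\<close> of squares. Its far
  part is \<Gamma>; its near part, multiplied by \<open>1 - q\<close>, is paid for by the starts of
  the runs. This is where the factor \<open>1 - q\<close> is needed.\<close>

lemma PL_sequence:
  "(1 - q) * (\<Sum>k=1..N. u k * ((z k - z (k - 1))\<^sup>2 / 52 + well (z k))) \<le> 15000 * G2"
proof -
  define Z where "Z = (\<Sum>k=1..N. u k * (z k)\<^sup>2)"
  have nn: "0 \<le> u k * (z k)\<^sup>2" for k by (simp add: less_imp_le u_pos)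
  have "(\<Sum>k=1..N. u k * (z (k - 1))\<^sup>2) \<le> sum (\<lambda>k. if k = 0 then 0 else u k * (z k)\<^sup>2) {0..N}"
  proof (rule sum_shift_le[where \<sigma> = "\<lambda>k. k - 1"])
    show "inj_on (\<lambda>k. k - 1) {1..N}" by (rule inj_onI) auto
    fix k assume "k \<in> {1..N}"
    then show "u k * (z (k - 1))\<^sup>2 \<le> (if k - 1 = 0 then 0 else u (k - 1) * (z (k - 1))\<^sup>2)"
      using u_pred[of k] z_0 by (auto intro!: mult_right_mono)
  qed (use nn in auto)
  also have "\<dots> = Z" unfolding Z_def by (subst sum.atLeast_Suc_atMost) (auto intro!: sum.cong)
  finally have shift: "(\<Sum>k=1..N. u k * (z (k - 1))\<^sup>2) \<le> Z" .
  have "(\<Sum>k=1..N. u k * ((z k - z (k - 1))\<^sup>2 / 52 + well (z k)))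
      \<le> (\<Sum>k=1..N. 7/13 * (u k * (z k)\<^sup>2) + 1/26 * (u k * (z (k - 1))\<^sup>2))"
  proof (rule sum_mono)
    fix k
    have "(z k - z (k - 1))\<^sup>2 / 52 + well (z k) \<le> 7/13 * (z k)\<^sup>2 + 1/26 * (z (k - 1))\<^sup>2"
      using sq_sum2_le[of "z k" "- z (k - 1)"] well_bounds(2)[of "z k"] by simp
    from mult_left_mono[OF this less_imp_le[OF u_pos[of k]]]
    show "u k * ((z k - z (k - 1))\<^sup>2 / 52 + well (z k))
        \<le> 7/13 * (u k * (z k)\<^sup>2) + 1/26 * (u k * (z (k - 1))\<^sup>2)" by (simp add: algebra_simps)
  qed
  also have "\<dots> = 7/13 * Z + 1/26 * (\<Sum>k=1..N. u k * (z (k - 1))\<^sup>2)"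
    by (simp only: sum.distrib sum_distrib_left Z_def)
  also have "\<dots> \<le> 15/26 * Z" using shift by simp
  finally have "(1 - q) * (\<Sum>k=1..N. u k * ((z k - z (k - 1))\<^sup>2 / 52 + well (z k)))
      \<le> (1 - q) * (15/26 * Z)" using q by (intro mult_left_mono) auto
  also have "\<dots> = 15/26 * ((1 - q) * Z)" by simp
  also have "(1 - q) * Z \<le> 1/4 * \<Gamma> + 121/100 * R"
  proof -
    have "Z = \<Gamma> + (\<Sum>k\<in>near. u k * (z k)\<^sup>2)"
      unfolding Z_def \<Gamma>_def far_def by (subst sum.subset_diff[of near]) (auto simp: near_def)
    moreover have "(\<Sum>k\<in>near. u k * (z k)\<^sup>2) \<le> 121/100 * sum u near"
      unfolding sum_distrib_left
      using near_z u_pos by (intro sum_mono) (auto simp: mult.commute less_imp_le intro!: mult_left_mono)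
    ultimately have "(1 - q) * Z \<le> (1 - q) * (\<Gamma> + 121/100 * sum u near)"
      using q by (intro mult_left_mono) auto
    also have "\<dots> = (1 - q) * \<Gamma> + 121/100 * ((1 - q) * sum u near)" by (simp add: algebra_simps)
    also have "(1 - q) * \<Gamma> \<le> 1/4 * \<Gamma>"
      using q nn by (intro mult_right_mono) (auto simp: \<Gamma>_def intro: sum_nonneg)
    finally show ?thesis using runs(1) by (simp add: R_def)
  qed
  finally have "(1 - q) * (\<Sum>k=1..N. u k * ((z k - z (k - 1))\<^sup>2 / 52 + well (z k)))
      \<le> 15/104 * \<Gamma> + 363/520 * R" by simp
  moreover have "0 \<le> G2" using G2_subset[of "{}"] by simp
  \<comment> \<open>Inserting one bound into the other puts 39 * 8 = 312 times \<Gamma> against 636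
    times \<Gamma>, so \<Gamma> and \<open>R\<close> are both bounded by multiples of
    \<open>G2\<close>.\<close>
  ultimately show ?thesis using far_bound start_bound by linarith
qed

end

section \<open>The hard function\<close>

lemma sum_1_eq: "(\<Sum>k=1..n. g k) = (\<Sum>j<n. g (Suc j))" for n :: nat
  by (simp add: sum.atLeast1_atMost_eq)

lemma vnorm_sq: "v \<in> carrier_vec d \<Longrightarrow> (vnorm v)\<^sup>2 = (\<Sum>j<d. (v $ j)\<^sup>2)"
proof -
  assume "v \<in> carrier_vec d"
  then have "v \<bullet> v = (\<Sum>j<d. (v $ j)\<^sup>2)"
    by (simp add: scalar_prod_def lessThan_atLeast0 power2_eq_square)
  then show ?thesis by (simp add: vnorm_def sum_nonneg)
qed

lemma vnorm_nonneg: "0 \<le> vnorm v"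
  by (simp add: vnorm_def scalar_prod_def sum_nonneg)

text \<open>Along a short multiple \<open>h\<close> of \<open>w = g - g'\<close> the linear terms
  differ by the full product of the norms of \<open>w\<close> and \<open>h\<close>, while the two
  errors allow only half of it.\<close>

lemma has_gradient_unique:
  assumes "has_gradient d f g x" "has_gradient d f g' x"
  shows "g = g'"
proof -
  define w where "w = g - g'"
  have car: "g \<in> carrier_vec d" "g' \<in> carrier_vec d" "w \<in> carrier_vec d"
    using assms by (auto simp: has_gradient_def w_def)
  have "vnorm w = 0"
  proof (rule ccontr)
    assume "vnorm w \<noteq> 0"
    then have pos: "vnorm w > 0" using vnorm_nonneg[of w] by simp
    define e where "e = vnorm w / 4"
    have e: "e > 0" using pos by (simp add: e_def)
    from assms(1) e obtain \<delta> where \<delta>: "\<delta> > 0"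
      "\<And>h. h \<in> carrier_vec d \<Longrightarrow> vnorm h < \<delta> \<Longrightarrow> \<bar>f (x + h) - f x - g \<bullet> h\<bar> \<le> e * vnorm h"
      unfolding has_gradient_def by blast
    from assms(2) e obtain \<delta>' where \<delta>': "\<delta>' > 0"
      "\<And>h. h \<in> carrier_vec d \<Longrightarrow> vnorm h < \<delta>' \<Longrightarrow> \<bar>f (x + h) - f x - g' \<bullet> h\<bar> \<le> e * vnorm h"
      unfolding has_gradient_def by blast
    define t where "t = min \<delta> \<delta>' / (2 * vnorm w)"
    have t: "t > 0" using \<delta>(1) \<delta>'(1) pos by (simp add: t_def)
    define h where "h = t \<cdot>\<^sub>v w"
    have h: "h \<in> carrier_vec d" using car by (simp add: h_def)
    have nh: "vnorm h = t * vnorm w"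
      using t car by (simp add: h_def vnorm_def real_sqrt_mult)
    then have "vnorm h = min \<delta> \<delta>' / 2" using pos by (simp add: t_def)
    then have "vnorm h < \<delta>" "vnorm h < \<delta>'" using \<delta>(1) \<delta>'(1) by auto
    then have "\<bar>g \<bullet> h - g' \<bullet> h\<bar> \<le> 2 * e * vnorm h"
      using \<delta>(2)[OF h] \<delta>'(2)[OF h] by linarith
    moreover have "g \<bullet> h - g' \<bullet> h = w \<bullet> h"
      using car h by (simp add: w_def minus_scalar_prod_distrib[where n = d])
    moreover have "w \<bullet> h = t * (vnorm w)\<^sup>2"
      using car by (simp add: h_def vnorm_def scalar_prod_def sum_nonneg sum_distrib_left mult.left_commute)
    ultimately have "t * (vnorm w)\<^sup>2 \<le> t * (vnorm w)\<^sup>2 / 2"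
      unfolding nh e_def using t by (simp add: power2_eq_square)
    then show False using t pos by simp
  qed
  then have "(\<Sum>j<d. (w $ j)\<^sup>2) = 0" using vnorm_sq[OF car(3)] by simp
  then have "w $ j = 0" if "j < d" for j using that by (subst (asm) sum_nonneg_eq_0_iff) auto
  then show ?thesis using car by (intro eq_vecI) (auto simp: w_def)
qed

lemma gradient_eqI: "has_gradient d f g x \<Longrightarrow> gradient d f x = g"
  unfolding gradient_def using has_gradient_unique by blast

lemma has_gradient_quadratic:
  assumes "g \<in> carrier_vec d" "0 \<le> C"
    and "\<And>h. h \<in> carrier_vec d \<Longrightarrow> \<bar>f (x + h) - f x - g \<bullet> h\<bar> \<le> C * (vnorm h)\<^sup>2"
  shows "has_gradient d f g x"
  unfolding has_gradient_def
proof (intro conjI allI impI)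
  fix e :: real assume e: "e > 0"
  show "\<exists>\<delta>>0. \<forall>h\<in>carrier_vec d. vnorm h < \<delta> \<longrightarrow> \<bar>f (x + h) - f x - g \<bullet> h\<bar> \<le> e * vnorm h"
  proof (intro exI[of _ "e / (C + 1)"] conjI ballI impI)
    fix h :: "real vec" assume h: "h \<in> carrier_vec d" "vnorm h < e / (C + 1)"
    then have "(C + 1) * vnorm h \<le> e" using assms(2) by (simp add: field_simps)
    then have "(C + 1) * vnorm h * vnorm h \<le> e * vnorm h" using vnorm_nonneg by (rule mult_right_mono)
    moreover have "C * (vnorm h)\<^sup>2 \<le> (C + 1) * vnorm h * vnorm h"
      by (simp add: power2_eq_square algebra_simps)
    ultimately show "\<bar>f (x + h) - f x - g \<bullet> h\<bar> \<le> e * vnorm h" using assms(3)[OF h(1)] by linarith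
  qed (use e assms(2) in simp)
qed (rule assms(1))

text \<open>\<open>r\<close> is the square root of the ratio of consecutive weights: coordinates are
  divided by \<open>y k\<close>, whose square is the weight, so that the Euclidean norm becomes the
  weighted norm. \<open>lam\<close> sets the smoothness and \<open>lam * A\<^sup>2\<close> the
  height of the function.\<close>

locale hard_chain =
  fixes N :: nat and r A lam :: real
  assumes N: "N \<ge> 1" and r: "0 < r" "3/4 \<le> r\<^sup>2" "r\<^sup>2 < 1" and A: "A > 0" and lam: "lam > 0"
begin

definition y :: "nat \<Rightarrow> real" where "y k = A * r ^ k"

text \<open>Coordinate \<open>j\<close> of a vector is the \<open>j + 1\<close>st member of a chain that starts at a fixed
  member with index \<open>0\<close> and is continued as a constant beyond \<open>N\<close>.\<close>

definition scaled :: "real vec \<Rightarrow> nat \<Rightarrow> real" where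
  "scaled h k = (if k = 0 then 0 else h $ (min k N - 1) / y (min k N))"

definition pos :: "real vec \<Rightarrow> nat \<Rightarrow> real" where
  "pos x k = of_bool (k \<noteq> 0) + scaled x k"

text \<open>The coefficients \<open>c\<close> of the links are all in which the agents differ; the
  potential is common to them. Constant 1 gives the objective.\<close>

definition hard :: "(nat \<Rightarrow> real) \<Rightarrow> real vec \<Rightarrow> real" where
  "hard c x = lam * (\<Sum>k=1..N. (y k)\<^sup>2 * (c k * (pos x k - pos x (k - 1))\<^sup>2 / 52 + well (pos x k)))"

definition hard_grad :: "(nat \<Rightarrow> real) \<Rightarrow> real vec \<Rightarrow> real vec" where
  "hard_grad c x = vec N (\<lambda>j. lam * y (Suc j) * (dwell (pos x (Suc j))
     + c (Suc j) * (pos x (Suc j) - pos x j) / 26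
     - r\<^sup>2 * c (Suc (Suc j)) * (pos x (Suc (Suc j)) - pos x (Suc j)) / 26))"

section \<open>Rescaled coordinates and shifted sums\<close>

lemma y_pos: "y k > 0" using A r by (simp add: y_def)

lemma y_sq_Suc: "(y (Suc k))\<^sup>2 = r\<^sup>2 * (y k)\<^sup>2"
  by (simp add: y_def power_mult_distrib algebra_simps)

lemma y_sq_decr: "(y (Suc k))\<^sup>2 \<le> (y k)\<^sup>2"
  unfolding y_sq_Suc using r by (simp add: mult_left_le_one_le)

lemma scaled_0 [simp]: "scaled h 0 = 0" and scaled_end: "scaled h (Suc N) = scaled h N"
  using N by (auto simp: scaled_def)

lemma pos_0 [simp]: "pos h 0 = 0" and pos_end: "pos h (Suc N) = pos h N"
  using N by (auto simp: pos_def scaled_end)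

lemma scaled_Suc: "j < N \<Longrightarrow> scaled h (Suc j) = h $ j / y (Suc j)"
  by (simp add: scaled_def min_def)

lemma scaled_linear:
  assumes "x \<in> carrier_vec N" "h \<in> carrier_vec N"
  shows "scaled (x + h) k = scaled x k + scaled h k" "scaled (x - h) k = scaled x k - scaled h k"
  using assms N by (auto simp: scaled_def add_divide_distrib diff_divide_distrib min_def)

lemma pos_add: "x \<in> carrier_vec N \<Longrightarrow> h \<in> carrier_vec N \<Longrightarrow> pos (x + h) k = pos x k + scaled h k"
  by (simp add: pos_def scaled_linear)

lemma pos_eq_1: "k \<ge> 1 \<Longrightarrow> x $ (min k N - 1) = 0 \<Longrightarrow> pos x k = 1"
  by (simp add: pos_def scaled_def)

lemma vnorm_scaled:
  assumes "h \<in> carrier_vec N"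
  shows "(vnorm h)\<^sup>2 = (\<Sum>k=1..N. (y k)\<^sup>2 * (scaled h k)\<^sup>2)"
proof -
  have "(\<Sum>k=1..N. (y k)\<^sup>2 * (scaled h k)\<^sup>2) = (\<Sum>j<N. (y (Suc j))\<^sup>2 * (scaled h (Suc j))\<^sup>2)"
    by (rule sum_1_eq)
  also have "\<dots> = (\<Sum>j<N. (h $ j)\<^sup>2)"
  proof (rule sum.cong)
    fix j assume "j \<in> {..<N}"
    then show "(y (Suc j))\<^sup>2 * (scaled h (Suc j))\<^sup>2 = (h $ j)\<^sup>2"
      using y_pos[of "Suc j"] by (simp add: scaled_Suc power_divide)
  qed simp
  finally show ?thesis using vnorm_sq[OF assms] by simp
qed

lemma sum_prev_le:
  assumes "a 0 = 0" "\<And>k. 0 \<le> a k"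
  shows "(\<Sum>k=1..N. (y k)\<^sup>2 * a (k - 1)) \<le> (\<Sum>k=1..N. (y k)\<^sup>2 * a k)"
proof -
  obtain M where M: "N = Suc M" using N by (cases N) auto
  have "(\<Sum>k=1..N. (y k)\<^sup>2 * a (k - 1)) = (\<Sum>j<N. (y (Suc j))\<^sup>2 * a j)"
    using sum_1_eq[of "\<lambda>k. (y k)\<^sup>2 * a (k - 1)"] by simp
  also have "\<dots> \<le> (\<Sum>j<N. (y j)\<^sup>2 * a j)"
    using y_sq_decr assms(2) by (intro sum_mono mult_right_mono) auto
  also have "\<dots> = (\<Sum>j<M. (y (Suc j))\<^sup>2 * a (Suc j))"
    unfolding M by (subst sum.lessThan_Suc_shift) (simp add: assms(1))
  also have "\<dots> \<le> (\<Sum>j<N. (y (Suc j))\<^sup>2 * a (Suc j))"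
    unfolding M using assms(2) by simp
  also have "\<dots> = (\<Sum>k=1..N. (y k)\<^sup>2 * a k)" by (rule sum_1_eq[symmetric])
  finally show ?thesis .
qed

text \<open>One factor \<open>r\<^sup>2\<close> turns the weight of \<open>k\<close> into that of
  \<open>Suc k\<close>. The constant continuation repeats the term of \<open>N\<close>, hence the
  factor 2.\<close>

lemma sum_next_le:
  assumes "a (Suc N) = a N" "\<And>k. 0 \<le> a k"
  shows "(\<Sum>k=1..N. (y k)\<^sup>2 * ((r\<^sup>2)\<^sup>2 * a (Suc k))) \<le> 2 * (\<Sum>k=1..N. (y k)\<^sup>2 * a k)"
proof -
  obtain M where M: "N = Suc M" using N by (cases N) auto
  have r2: "(r\<^sup>2)\<^sup>2 \<le> r\<^sup>2" "(r\<^sup>2)\<^sup>2 \<le> 1" using r by (simp_all add: power2_eq_square mult_left_le_one_le mult_le_one)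
  have le: "(y k)\<^sup>2 * ((r\<^sup>2)\<^sup>2 * a (Suc k)) \<le> (y (Suc k))\<^sup>2 * a (Suc k)" for k
  proof -
    have "(y k)\<^sup>2 * ((r\<^sup>2)\<^sup>2 * a (Suc k)) = (r\<^sup>2)\<^sup>2 * ((y k)\<^sup>2 * a (Suc k))" by simp
    also have "\<dots> \<le> r\<^sup>2 * ((y k)\<^sup>2 * a (Suc k))"
      using assms(2) r2 by (intro mult_right_mono) auto
    finally show ?thesis by (simp add: y_sq_Suc algebra_simps)
  qed
  have last: "(y N)\<^sup>2 * ((r\<^sup>2)\<^sup>2 * a (Suc N)) \<le> (y N)\<^sup>2 * a N"
    using r2 assms by (intro mult_left_mono) (auto simp: mult_left_le_one_le)
  have "(\<Sum>k=1..N. (y k)\<^sup>2 * ((r\<^sup>2)\<^sup>2 * a (Suc k)))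
      = (\<Sum>j<M. (y (Suc j))\<^sup>2 * ((r\<^sup>2)\<^sup>2 * a (Suc (Suc j)))) + (y N)\<^sup>2 * ((r\<^sup>2)\<^sup>2 * a (Suc N))"
    unfolding sum_1_eq M by simp
  also have "\<dots> \<le> (\<Sum>j<M. (y (Suc (Suc j)))\<^sup>2 * a (Suc (Suc j))) + (y N)\<^sup>2 * a N"
    using le last by (intro add_mono sum_mono) auto
  also have "(\<Sum>j<M. (y (Suc (Suc j)))\<^sup>2 * a (Suc (Suc j))) \<le> (\<Sum>j<N. (y (Suc j))\<^sup>2 * a (Suc j))"
    unfolding M using sum.lessThan_Suc_shift[of "\<lambda>j. (y (Suc j))\<^sup>2 * a (Suc j)" M] by (simp add: assms(2))
  also have "(\<Sum>j<N. (y (Suc j))\<^sup>2 * a (Suc j)) = (\<Sum>k=1..N. (y k)\<^sup>2 * a k)"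
    by (rule sum_1_eq[symmetric])
  also have "(y N)\<^sup>2 * a N \<le> (\<Sum>k=1..N. (y k)\<^sup>2 * a k)"
    using N assms(2) by (intro member_le_sum) auto
  finally show ?thesis by simp
qed

section \<open>Gradient and smoothness of the chain functions\<close>

lemma hard_grad_carrier [simp]: "hard_grad c x \<in> carrier_vec N"
  by (simp add: hard_grad_def)

lemma hard_grad_index:
  "j < N \<Longrightarrow> hard_grad c x $ j = lam * y (Suc j) * (dwell (pos x (Suc j))
     + c (Suc j) * (pos x (Suc j) - pos x j) / 26
     - r\<^sup>2 * c (Suc (Suc j)) * (pos x (Suc (Suc j)) - pos x (Suc j)) / 26)"
  by (simp add: hard_grad_def)

text \<open>Summation by parts. The boundary terms vanish because the chain is fixed at index 0 and
  constant beyond \<open>N\<close>.\<close>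

lemma hard_grad_scalar_prod:
  assumes "h \<in> carrier_vec N"
  shows "hard_grad c x \<bullet> h = lam * (\<Sum>k=1..N. (y k)\<^sup>2 * (dwell (pos x k) * scaled h k
    + c k * (pos x k - pos x (k - 1)) * (scaled h k - scaled h (k - 1)) / 26))"
proof -
  define e where "e k = (y k)\<^sup>2 * c k * (pos x k - pos x (k - 1))" for k
  have "hard_grad c x \<bullet> h = (\<Sum>j<N. hard_grad c x $ j * h $ j)"
    using assms by (simp add: scalar_prod_def lessThan_atLeast0)
  also have "\<dots> = (\<Sum>j<N. lam * ((y (Suc j))\<^sup>2 * dwell (pos x (Suc j)) * scaled h (Suc j)
      + e (Suc j) * scaled h (Suc j) / 26 - e (Suc (Suc j)) * scaled h (Suc j) / 26))"
  proof (rule sum.cong)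
    fix j assume "j \<in> {..<N}"
    then have "h $ j = y (Suc j) * scaled h (Suc j)" "j < N"
      using y_pos[of "Suc j"] by (simp_all add: scaled_Suc)
    then show "hard_grad c x $ j * h $ j = lam * ((y (Suc j))\<^sup>2 * dwell (pos x (Suc j)) * scaled h (Suc j)
      + e (Suc j) * scaled h (Suc j) / 26 - e (Suc (Suc j)) * scaled h (Suc j) / 26)"
      unfolding hard_grad_index[OF \<open>j < N\<close>] e_def y_sq_Suc[of "Suc j"]
      by (simp add: power2_eq_square algebra_simps diff_divide_distrib add_divide_distrib)
  qed simp
  also have "\<dots> = lam * ((\<Sum>j<N. (y (Suc j))\<^sup>2 * dwell (pos x (Suc j)) * scaled h (Suc j))
      + ((\<Sum>j<N. e (Suc j) * scaled h (Suc j)) - (\<Sum>j<N. e (Suc (Suc j)) * scaled h (Suc j))) / 26)"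
    by (simp only: sum_distrib_left[symmetric] sum.distrib sum_subtractf sum_divide_distrib[symmetric]
        add_diff_eq[symmetric] diff_divide_distrib[symmetric])
  also have "(\<Sum>j<N. e (Suc (Suc j)) * scaled h (Suc j)) = (\<Sum>j<N. e (Suc j) * scaled h j)"
  proof -
    have "(\<Sum>j<Suc N. e (Suc j) * scaled h j) = (\<Sum>j<N. e (Suc (Suc j)) * scaled h (Suc j))"
      by (subst sum.lessThan_Suc_shift) simp
    moreover have "e (Suc N) = 0" by (simp add: e_def pos_end)
    ultimately show ?thesis by simp
  qed
  also have "(\<Sum>j<N. e (Suc j) * scaled h (Suc j)) - (\<Sum>j<N. e (Suc j) * scaled h j)
      = (\<Sum>j<N. e (Suc j) * (scaled h (Suc j) - scaled h j))"
    by (simp add: sum_subtractf algebra_simps)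
  finally show ?thesis
    unfolding sum_1_eq e_def
    by (simp add: sum.distrib sum_divide_distrib algebra_simps)
qed

text \<open>The potential contributes 12 to the remainder, and a link with coefficient at most 3
  contributes 6/52, below 1/2, for each of its two ends; 12 + 1/2 + 1/2 = 13.\<close>

lemma hard_taylor:
  assumes c: "\<And>k. 0 \<le> c k \<and> c k \<le> 3" and x: "x \<in> carrier_vec N" and h: "h \<in> carrier_vec N"
  shows "\<bar>hard c (x + h) - hard c x - hard_grad c x \<bullet> h\<bar> \<le> lam * 13 * (vnorm h)\<^sup>2"
proof -
  define R where "R k = c k * (scaled h k - scaled h (k - 1))\<^sup>2 / 52
    + (well (pos x k + scaled h k) - well (pos x k) - dwell (pos x k) * scaled h k)" for k
  define S where "S = (\<Sum>k=1..N. (y k)\<^sup>2 * (scaled h k)\<^sup>2)"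
  have "hard c (x + h) - hard c x - hard_grad c x \<bullet> h = lam * (\<Sum>k=1..N. (y k)\<^sup>2 * R k)"
    unfolding hard_def hard_grad_scalar_prod[OF h] right_diff_distrib[symmetric] sum_subtractf[symmetric]
    by (intro arg_cong2[where f = "(*)"] sum.cong)
       (auto simp: R_def pos_add[OF x h] power2_eq_square field_simps)
  also have "\<bar>\<dots>\<bar> \<le> lam * (\<Sum>k=1..N. (y k)\<^sup>2 * (25/2 * (scaled h k)\<^sup>2 + 1/2 * (scaled h (k - 1))\<^sup>2))"
  proof -
    have "\<bar>R k\<bar> \<le> 25/2 * (scaled h k)\<^sup>2 + 1/2 * (scaled h (k - 1))\<^sup>2" for k
    proof -
      define P Q where "P = c k * (scaled h k - scaled h (k - 1))\<^sup>2"
        and "Q = well (pos x k + scaled h k) - well (pos x k) - dwell (pos x k) * scaled h k"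
      define a b where "a = (scaled h k)\<^sup>2" and "b = (scaled h (k - 1))\<^sup>2"
      have "P \<le> 3 * (2 * (a + b))"
        unfolding P_def using c[of k] sq_sum2_le[of "scaled h k" "- scaled h (k - 1)"]
        by (intro mult_mono) (auto simp: a_def b_def)
      then have "P \<le> 6 * a + 6 * b" by simp
      moreover have "0 \<le> P" using c[of k] by (simp add: P_def)
      moreover have "Q \<le> 12 * a" "- Q \<le> 12 * a"
        using well_taylor[of "pos x k" "scaled h k"] unfolding Q_def a_def abs_le_iff by auto
      moreover have "0 \<le> a" "0 \<le> b" by (simp_all add: a_def b_def)
      moreover have "R k = P / 52 + Q" by (simp add: R_def P_def Q_def)
      ultimately show ?thesis unfolding a_def[symmetric] b_def[symmetric] by (intro abs_leI) linarith+
    qed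
    then have "\<bar>\<Sum>k=1..N. (y k)\<^sup>2 * R k\<bar>
        \<le> (\<Sum>k=1..N. (y k)\<^sup>2 * (25/2 * (scaled h k)\<^sup>2 + 1/2 * (scaled h (k - 1))\<^sup>2))"
      by (intro order.trans[OF sum_abs] sum_mono) (simp add: abs_mult mult_left_mono)
    then show ?thesis using lam by (simp add: abs_mult)
  qed
  also have "(\<Sum>k=1..N. (y k)\<^sup>2 * (25/2 * (scaled h k)\<^sup>2 + 1/2 * (scaled h (k - 1))\<^sup>2))
      = 25/2 * S + 1/2 * (\<Sum>k=1..N. (y k)\<^sup>2 * (scaled h (k - 1))\<^sup>2)"
    unfolding S_def sum_distrib_left sum.distrib[symmetric]
    by (intro sum.cong) (simp_all add: algebra_simps)
  also have "lam * \<dots> \<le> lam * (13 * S)"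
    using sum_prev_le[of "\<lambda>k. (scaled h k)\<^sup>2"] lam by (intro mult_left_mono) (auto simp: S_def)
  finally show ?thesis unfolding S_def vnorm_scaled[OF h] by (simp add: mult.assoc)
qed

lemma hard_has_gradient:
  assumes "\<And>k. 0 \<le> c k \<and> c k \<le> 3" "x \<in> carrier_vec N"
  shows "has_gradient N (hard c) (hard_grad c x) x"
  using hard_taylor[OF assms] lam by (intro has_gradient_quadratic[where C = "lam * 13"]) auto

text \<open>Cauchy-Schwarz with the weights \<open>s, t, t\<close>; weights that match the
  coefficients keep the Lipschitz constant close to the dominant one.\<close>

lemma weighted_sq_le:
  fixes a b e s t :: real
  assumes "0 \<le> s" "0 \<le> t"
  shows "(s * a + t * b + t * e)\<^sup>2 \<le> (s + 2 * t) * (s * a\<^sup>2 + t * b\<^sup>2 + t * e\<^sup>2)"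
proof -
  have "(s + 2 * t) * (s * a\<^sup>2 + t * b\<^sup>2 + t * e\<^sup>2) - (s * a + t * b + t * e)\<^sup>2
      = s * t * (a - b)\<^sup>2 + s * t * (a - e)\<^sup>2 + t * t * (b - e)\<^sup>2"
    by (simp add: power2_eq_square algebra_simps)
  moreover have "0 \<le> s * t * (a - b)\<^sup>2" "0 \<le> s * t * (a - e)\<^sup>2" "0 \<le> t * t * (b - e)\<^sup>2"
    using assms by simp_all
  ultimately show ?thesis by linarith
qed

lemma hard_grad_lipschitz:
  assumes c: "\<And>k. 0 \<le> c k \<and> c k \<le> 3" and x: "x \<in> carrier_vec N" "x' \<in> carrier_vec N"
  shows "(vnorm (hard_grad c x - hard_grad c x'))\<^sup>2 \<le> (13 * lam)\<^sup>2 * (vnorm (x - x'))\<^sup>2"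
proof -
  define \<epsilon> where "\<epsilon> = scaled (x - x')"
  have diff: "pos x k - pos x' k = \<epsilon> k" for k
    using scaled_linear(2)[OF x] by (simp add: \<epsilon>_def pos_def)
  \<comment> \<open>\<open>s\<close> is 12 from \<open>dwell\<close> plus 3/26 from each of the two
    links, and \<open>t\<close> is the share of a neighbour. Then
    \<open>s + 2 * t \<le> 25/2\<close>, and 25/2 times \<open>s + 3 * t\<close> is 8175/52, below
    169.\<close>
  define s t :: real where "s = 159/13" and "t = 3/26"
  define S where "S = (\<Sum>k=1..N. (y k)\<^sup>2 * (\<epsilon> k)\<^sup>2)"
  have r2: "0 \<le> r\<^sup>2" "r\<^sup>2 \<le> 1" using r by auto
  have comp: "((hard_grad c x - hard_grad c x') $ j)\<^sup>2
      \<le> lam\<^sup>2 * ((y (Suc j))\<^sup>2 * (25/2 * (s * (\<epsilon> (Suc j))\<^sup>2 + t * (\<epsilon> j)\<^sup>2 + t * (r\<^sup>2 * \<epsilon> (Suc (Suc j)))\<^sup>2)))"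
    if j: "j < N" for j
  proof -
    define a b e where "a = \<bar>\<epsilon> (Suc j)\<bar>" and "b = \<bar>\<epsilon> j\<bar>" and "e = r\<^sup>2 * \<bar>\<epsilon> (Suc (Suc j))\<bar>"
    define D1 D2 D3 where "D1 = dwell (pos x (Suc j)) - dwell (pos x' (Suc j))"
      and "D2 = c (Suc j) * (\<epsilon> (Suc j) - \<epsilon> j)"
      and "D3 = r\<^sup>2 * c (Suc (Suc j)) * (\<epsilon> (Suc (Suc j)) - \<epsilon> (Suc j))"
    have grad_j: "(hard_grad c x - hard_grad c x') $ j = lam * y (Suc j) * (D1 + D2 / 26 - D3 / 26)"
      using j by (simp add: hard_grad_index D1_def D2_def D3_def diff[symmetric] field_simps)
        (simp add: hard_grad_def field_simps)
    have "\<bar>D1 + D2 / 26 - D3 / 26\<bar> \<le> s * a + t * b + t * e"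
    proof -
      have "\<bar>D1\<bar> \<le> 12 * a" using dwell_lipschitz[of "pos x (Suc j)" "pos x' (Suc j)"]
        by (simp add: D1_def a_def diff)
      moreover have "\<bar>D2\<bar> \<le> 3 * (a + b)"
        unfolding D2_def abs_mult a_def b_def using c[of "Suc j"] by (intro mult_mono) auto
      moreover have "\<bar>D3\<bar> \<le> 3 * (e + a)"
      proof -
        have "\<bar>D3\<bar> = c (Suc (Suc j)) * \<bar>r\<^sup>2 * \<epsilon> (Suc (Suc j)) - r\<^sup>2 * \<epsilon> (Suc j)\<bar>"
          using c[of "Suc (Suc j)"] by (simp add: D3_def abs_mult right_diff_distrib[symmetric])
        also have "\<dots> \<le> 3 * (\<bar>r\<^sup>2 * \<epsilon> (Suc (Suc j))\<bar> + \<bar>r\<^sup>2 * \<epsilon> (Suc j)\<bar>)"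
          using c[of "Suc (Suc j)"] by (intro mult_mono) auto
        also have "\<bar>r\<^sup>2 * \<epsilon> (Suc j)\<bar> \<le> a" using r2 by (simp add: abs_mult a_def mult_left_le_one_le)
        finally show ?thesis by (simp add: e_def abs_mult)
      qed
      ultimately have "\<bar>D1\<bar> \<le> 12 * a" "\<bar>D2\<bar> \<le> 3 * a + 3 * b" "\<bar>D3\<bar> \<le> 3 * e + 3 * a"
        by (simp_all add: distrib_left)
      then show ?thesis unfolding s_def t_def abs_le_iff by linarith
    qed
    then have "(D1 + D2 / 26 - D3 / 26)\<^sup>2 \<le> (s * a + t * b + t * e)\<^sup>2"
      by (metis abs_ge_zero power2_abs power_mono)
    also have "\<dots> \<le> (s + 2 * t) * (s * a\<^sup>2 + t * b\<^sup>2 + t * e\<^sup>2)"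
      by (rule weighted_sq_le) (simp_all add: s_def t_def)
    also have "\<dots> \<le> 25/2 * (s * a\<^sup>2 + t * b\<^sup>2 + t * e\<^sup>2)"
      by (intro mult_right_mono) (simp_all add: s_def t_def)
    also have "\<dots> = 25/2 * (s * (\<epsilon> (Suc j))\<^sup>2 + t * (\<epsilon> j)\<^sup>2 + t * (r\<^sup>2 * \<epsilon> (Suc (Suc j)))\<^sup>2)"
      by (simp add: a_def b_def e_def power_mult_distrib)
    finally have "(lam * y (Suc j))\<^sup>2 * (D1 + D2 / 26 - D3 / 26)\<^sup>2 \<le> (lam * y (Suc j))\<^sup>2 * \<dots>"
      by (intro mult_left_mono) auto
    then show ?thesis unfolding grad_j by (simp add: power_mult_distrib mult.assoc)
  qed
  have "(vnorm (hard_grad c x - hard_grad c x'))\<^sup>2 = (\<Sum>j<N. ((hard_grad c x - hard_grad c x') $ j)\<^sup>2)"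
    by (intro vnorm_sq) auto
  also have "\<dots> \<le> (\<Sum>j<N. lam\<^sup>2 * ((y (Suc j))\<^sup>2 *
      (25/2 * (s * (\<epsilon> (Suc j))\<^sup>2 + t * (\<epsilon> j)\<^sup>2 + t * (r\<^sup>2 * \<epsilon> (Suc (Suc j)))\<^sup>2))))"
    by (intro sum_mono comp) auto
  also have "\<dots> = (\<Sum>k=1..N. lam\<^sup>2 * ((y k)\<^sup>2 *
      (25/2 * (s * (\<epsilon> k)\<^sup>2 + t * (\<epsilon> (k - 1))\<^sup>2 + t * (r\<^sup>2 * \<epsilon> (Suc k))\<^sup>2))))"
    by (simp only: sum_1_eq diff_Suc_1)
  also have "\<dots> = lam\<^sup>2 * (25/2) * (s * S + t * (\<Sum>k=1..N. (y k)\<^sup>2 * (\<epsilon> (k - 1))\<^sup>2)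
      + t * (\<Sum>k=1..N. (y k)\<^sup>2 * ((r\<^sup>2)\<^sup>2 * (\<epsilon> (Suc k))\<^sup>2)))"
    unfolding S_def sum_distrib_left sum.distrib[symmetric]
    by (intro sum.cong) (simp_all add: power_mult_distrib algebra_simps)
  also have "\<dots> \<le> lam\<^sup>2 * (25/2) * (s * S + t * S + t * (2 * S))"
    using sum_prev_le[of "\<lambda>k. (\<epsilon> k)\<^sup>2"] sum_next_le[of "\<lambda>k. (\<epsilon> k)\<^sup>2"]
    by (intro mult_left_mono add_mono) (auto simp: S_def \<epsilon>_def scaled_end s_def t_def)
  also have "\<dots> = lam\<^sup>2 * (8175/52) * S" by (simp add: s_def t_def)
  also have "\<dots> \<le> (13 * lam)\<^sup>2 * S"
  proof (rule mult_right_mono)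
    show "0 \<le> S" by (simp add: S_def sum_nonneg)
  qed (use lam in \<open>simp add: power_mult_distrib\<close>)
  finally show ?thesis
    using x by (simp add: vnorm_scaled S_def \<epsilon>_def)
qed

text \<open>A zero coordinate sits at position 1, where the potential exerts no force. Only a link
  to a coordinate that has moved, or the first link to the fixed start, can pull on it.\<close>

lemma hard_grad_reveals:
  assumes "j < N" "hard_grad c x $ j \<noteq> 0"
  shows "x $ j \<noteq> 0 \<or> c (Suc j) \<noteq> 0 \<and> (j = 0 \<or> x $ (j - 1) \<noteq> 0)
    \<or> c (Suc (Suc j)) \<noteq> 0 \<and> Suc j < N \<and> x $ (Suc j) \<noteq> 0"
proof (rule ccontr)
  assume neg: "\<not> ?thesis"
  have pos_Suc: "pos x (Suc k) = 1" if "k < N" "x $ k = 0" for k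
    using that pos_eq_1[of "Suc k" x] by (simp add: min_def)
  have j: "pos x (Suc j) = 1" using neg assms(1) pos_Suc by blast
  have 1: "c (Suc j) * (pos x (Suc j) - pos x j) = 0"
  proof (cases "c (Suc j) = 0")
    case False
    then have "pos x j = 1" using neg assms(1) pos_Suc[of "j - 1"] by auto
    then show ?thesis using j by simp
  qed simp
  have 2: "r\<^sup>2 * c (Suc (Suc j)) * (pos x (Suc (Suc j)) - pos x (Suc j)) = 0"
  proof (cases "c (Suc (Suc j)) = 0")
    case False
    have "pos x (Suc (Suc j)) = pos x (Suc j)"
    proof (cases "Suc j < N")
      case True
      then show ?thesis using False neg pos_Suc[of "Suc j"] j by auto
    next
      case False
      then have "Suc j = N" using assms(1) by simp
      then show ?thesis using pos_end by simp
    qed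
    then show ?thesis by simp
  qed simp
  have "hard_grad c x $ j = 0" unfolding hard_grad_index[OF assms(1)] 1 2 by (simp add: j)
  with assms(2) show False by simp
qed

section \<open>Infimum, PL inequality and values of the objective\<close>

lemma hard_nonneg: "(\<And>k. 0 \<le> c k) \<Longrightarrow> 0 \<le> hard c x"
  unfolding hard_def using lam well_bounds(1)
  by (intro mult_nonneg_nonneg sum_nonneg add_nonneg_nonneg divide_nonneg_pos) auto

lemma inf_hard:
  assumes "\<And>k. 0 \<le> c k"
  shows "bdd_below (hard c ` carrier_vec N)" "inf_value N (hard c) = 0"
proof -
  show bdd: "bdd_below (hard c ` carrier_vec N)"
    using hard_nonneg[OF assms] by (intro bdd_belowI[of _ 0]) auto
  \<comment> \<open>The minimiser: it moves every position from 1 to 0.\<close>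
  define x where "x = vec N (\<lambda>j. - y (Suc j))"
  have "pos x k = 0" for k
  proof (cases k)
    case (Suc j)
    have "0 < min k N" "min k N - 1 < N" using Suc N by auto
    then show ?thesis using y_pos[of "min k N"] Suc by (simp add: pos_def scaled_def x_def)
  qed simp
  then have "hard c x = 0" by (simp add: hard_def)
  moreover have "x \<in> carrier_vec N" by (simp add: x_def)
  ultimately have "inf_value N (hard c) \<le> 0"
    unfolding inf_value_def using cINF_lower[OF bdd] by metis
  moreover have "0 \<le> inf_value N (hard c)"
    unfolding inf_value_def
  proof (rule cINF_greatest)
    show "carrier_vec N \<noteq> ({} :: real vec set)" using zero_carrier_vec by blast
  qed (rule hard_nonneg[OF assms])
  ultimately show "inf_value N (hard c) = 0" by simp
qed

text \<open>Entry \<open>j\<close> of the gradient is \<open>lam * y (Suc j) * G (Suc j)\<close>, so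
  its squared norm is \<open>lam\<^sup>2 * G2\<close>, and \<open>PL_sequence\<close>
  applies.\<close>

lemma hard_PL:
  assumes "x \<in> carrier_vec N"
  shows "(1 - r\<^sup>2) * hard (\<lambda>_. 1) x \<le> 15000 / lam * (vnorm (hard_grad (\<lambda>_. 1) x))\<^sup>2"
proof -
  interpret geometric_chain N "r\<^sup>2" "\<lambda>k. (y k)\<^sup>2" "pos x"
    using r by unfold_locales (auto simp: y_sq_Suc pos_end y_pos[THEN less_imp_neq, symmetric])
  have "(vnorm (hard_grad (\<lambda>_. 1) x))\<^sup>2 = (\<Sum>j<N. (hard_grad (\<lambda>_. 1) x $ j)\<^sup>2)"
    by (intro vnorm_sq) simp
  also have "\<dots> = (\<Sum>j<N. lam\<^sup>2 * ((y (Suc j))\<^sup>2 * (G (Suc j))\<^sup>2))"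
    by (intro sum.cong) (simp_all add: hard_grad_index G_def power_mult_distrib)
  also have "\<dots> = lam\<^sup>2 * G2"
    by (simp only: G2_def sum_1_eq sum_distrib_left)
  finally have "lam * (15000 * G2) = 15000 / lam * (vnorm (hard_grad (\<lambda>_. 1) x))\<^sup>2"
    using lam by (simp add: power2_eq_square)
  moreover have "(1 - r\<^sup>2) * hard (\<lambda>_. 1) x \<le> lam * (15000 * G2)"
    using mult_left_mono[OF PL_sequence less_imp_le[OF lam]] by (simp add: hard_def algebra_simps)
  ultimately show ?thesis by simp
qed

lemma average_hard:
  assumes "n > 0" and avg: "\<And>k. 1 \<le> k \<Longrightarrow> k \<le> N \<Longrightarrow> (\<Sum>i<n. c i k) = real n"
  shows "average n (\<lambda>i. hard (c i)) = hard (\<lambda>_. 1)"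
proof
  fix x
  define a b where "a k = (pos x k - pos x (k - 1))\<^sup>2 / 52" and "b k = well (pos x k)" for k
  have "(\<Sum>i<n. hard (c i) x) = lam * (\<Sum>i<n. \<Sum>k=1..N. (y k)\<^sup>2 * (c i k * a k + b k))"
    by (simp add: hard_def sum_distrib_left a_def b_def)
  also have "(\<Sum>i<n. \<Sum>k=1..N. (y k)\<^sup>2 * (c i k * a k + b k))
      = (\<Sum>k=1..N. \<Sum>i<n. (y k)\<^sup>2 * (c i k * a k + b k))" by (rule sum.swap)
  also have "\<dots> = (\<Sum>k=1..N. real n * ((y k)\<^sup>2 * (a k + b k)))"
  proof (rule sum.cong)
    fix k assume "k \<in> {1..N}"
    have "(\<Sum>i<n. (y k)\<^sup>2 * (c i k * a k + b k)) = (y k)\<^sup>2 * ((\<Sum>i<n. c i k) * a k + real n * b k)"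
      by (simp add: sum_distrib_left[symmetric] sum.distrib sum_distrib_right)
    with \<open>k \<in> {1..N}\<close> avg show "(\<Sum>i<n. (y k)\<^sup>2 * (c i k * a k + b k)) = real n * ((y k)\<^sup>2 * (a k + b k))"
      by (simp add: algebra_simps)
  qed simp
  also have "\<dots> = real n * (\<Sum>k=1..N. (y k)\<^sup>2 * (a k + b k))" by (simp add: sum_distrib_left)
  finally show "average n (\<lambda>i. hard (c i)) x = hard (\<lambda>_. 1) x"
    using assms(1) by (simp add: average_def hard_def a_def b_def)
qed

lemma hard_origin: "hard (\<lambda>_. 1) (0\<^sub>v N) \<le> lam * A\<^sup>2 / (1 - r\<^sup>2)"
proof -
  have z: "pos (0\<^sub>v N) k = of_bool (k \<noteq> 0)" for k
    using N by (auto simp: pos_def scaled_def)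
  have r2: "0 \<le> r\<^sup>2" "r\<^sup>2 < 1" using r by auto
  have "(\<Sum>k=1..N. (y k)\<^sup>2 * (1 * (pos (0\<^sub>v N) k - pos (0\<^sub>v N) (k - 1))\<^sup>2 / 52 + well (pos (0\<^sub>v N) k)))
      \<le> (\<Sum>k=1..N. (y k)\<^sup>2)"
  proof (rule sum_mono)
    fix k assume "k \<in> {1..N}"
    have "(y k)\<^sup>2 * (1 * (pos (0\<^sub>v N) k - pos (0\<^sub>v N) (k - 1))\<^sup>2 / 52 + well (pos (0\<^sub>v N) k)) \<le> (y k)\<^sup>2 * 1"
      using well_bounds(2)[of 1] well_bounds(2)[of 0] by (intro mult_left_mono) (auto simp: z)
    then show "(y k)\<^sup>2 * (1 * (pos (0\<^sub>v N) k - pos (0\<^sub>v N) (k - 1))\<^sup>2 / 52 + well (pos (0\<^sub>v N) k)) \<le> (y k)\<^sup>2"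
      by simp
  qed
  also have "\<dots> = (\<Sum>k=1..N. A\<^sup>2 * (r\<^sup>2) ^ k)"
    by (simp add: y_def power_mult_distrib power_mult[symmetric] mult.commute)
  also have "\<dots> \<le> (\<Sum>k<Suc N. A\<^sup>2 * (r\<^sup>2) ^ k)" by (intro sum_mono2) auto
  also have "\<dots> = A\<^sup>2 * ((1 - (r\<^sup>2) ^ Suc N) / (1 - r\<^sup>2))"
    unfolding sum_distrib_left[symmetric] using r2 by (subst sum_gp_strict) auto
  also have "\<dots> \<le> A\<^sup>2 * (1 / (1 - r\<^sup>2))"
    using r2 by (intro mult_left_mono divide_right_mono) auto
  finally show ?thesis
    unfolding hard_def using mult_left_mono[OF _ less_imp_le[OF lam]] by (fastforce simp: mult.assoc)
qed

text \<open>Each zero coordinate costs at least 3/10 of its weight, and the geometric tail starting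
  at \<open>Suc K\<close> carries a factor \<open>r\<^sup>2 \<ge> 3/4\<close>; 9/40 is the product
  of the two.\<close>

lemma hard_unrevealed:
  assumes "K \<le> N" and "\<And>j. K \<le> j \<Longrightarrow> j < N \<Longrightarrow> x $ j = 0"
  shows "9/40 * (lam * A\<^sup>2 / (1 - r\<^sup>2)) * ((r\<^sup>2) ^ K - (r\<^sup>2) ^ N) \<le> hard (\<lambda>_. 1) x"
proof -
  have r2: "3/4 \<le> r\<^sup>2" "r\<^sup>2 < 1" using r by auto
  define X where "X = (r\<^sup>2) ^ K - (r\<^sup>2) ^ N"
  have "(\<Sum>k=Suc K..N. (r\<^sup>2) ^ k) = ((r\<^sup>2) ^ Suc K - (r\<^sup>2) ^ Suc N) / (1 - r\<^sup>2)"
  proof (cases "K = N")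
    case False
    then show ?thesis using assms(1) r2 by (subst sum_gp) auto
  qed simp
  also have "\<dots> = r\<^sup>2 * (((r\<^sup>2) ^ K - (r\<^sup>2) ^ N) / (1 - r\<^sup>2))"
    by (simp add: right_diff_distrib)
  also have "\<dots> \<ge> 3/4 * (((r\<^sup>2) ^ K - (r\<^sup>2) ^ N) / (1 - r\<^sup>2))"
    using r2 assms(1) by (intro mult_right_mono divide_nonneg_pos) (auto intro: power_decreasing)
  finally have "3/10 * (A\<^sup>2 * (3/4 * (((r\<^sup>2) ^ K - (r\<^sup>2) ^ N) / (1 - r\<^sup>2))))
      \<le> 3/10 * (A\<^sup>2 * (\<Sum>k=Suc K..N. (r\<^sup>2) ^ k))"
    by (intro mult_left_mono) auto
  also have "\<dots> = (\<Sum>k=Suc K..N. (y k)\<^sup>2 * (3/10))"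
    by (simp add: sum_distrib_left y_def power_mult_distrib power_mult[symmetric] mult.commute)
  also have "\<dots> \<le> (\<Sum>k=Suc K..N. (y k)\<^sup>2 * (1 * (pos x k - pos x (k - 1))\<^sup>2 / 52 + well (pos x k)))"
  proof (rule sum_mono)
    fix k assume k: "k \<in> {Suc K..N}"
    then have "pos x k = 1" using assms(2)[of "k - 1"] by (intro pos_eq_1) (auto simp: min_def)
    then show "(y k)\<^sup>2 * (3/10) \<le> (y k)\<^sup>2 * (1 * (pos x k - pos x (k - 1))\<^sup>2 / 52 + well (pos x k))"
      using well_1 by (intro mult_left_mono) (auto intro: add_increasing)
  qed
  also have "\<dots> \<le> (\<Sum>k=1..N. (y k)\<^sup>2 * (1 * (pos x k - pos x (k - 1))\<^sup>2 / 52 + well (pos x k)))"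
    using well_bounds(1) by (intro sum_mono2) auto
  finally have "lam * (3/10 * (A\<^sup>2 * (3/4 * (((r\<^sup>2) ^ K - (r\<^sup>2) ^ N) / (1 - r\<^sup>2))))) \<le> hard (\<lambda>_. 1) x"
    unfolding hard_def using lam by (intro mult_left_mono) auto
  then show ?thesis unfolding X_def[symmetric] by (simp add: mult.left_commute)
qed

end

section \<open>The lower bound\<close>

text \<open>With \<open>m\<close> agents sharing each link, the factor \<open>n / m\<close> makes
  its average coefficient 1. Groups of at least a third of the agents keep it at most 3; agents
  between the groups hold the potential only.\<close>

definition group_coeff :: "nat \<Rightarrow> nat \<Rightarrow> nat \<Rightarrow> nat \<Rightarrow> real" where
  "group_coeff n m i k = (if i < m \<and> odd k \<or> n - m \<le> i \<and> even k then real n / real m else 0)"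

lemma group_coeff_bounds:
  assumes "1 \<le> m" "n \<le> 3 * m"
  shows "0 \<le> group_coeff n m i k \<and> group_coeff n m i k \<le> 3"
proof -
  have "real n \<le> 3 * real m" using assms(2) by linarith
  then have "real n / real m \<le> 3" using assms(1) by (simp add: divide_le_eq)
  then show ?thesis by (simp add: group_coeff_def)
qed

lemma group_coeff_sum:
  assumes "1 \<le> m" "m \<le> n"
  shows "(\<Sum>i<n. group_coeff n m i k) = real n"
proof -
  define S where "S = (if odd k then {..<m} else {n - m..<n})"
  have "(\<Sum>i<n. group_coeff n m i k) = (\<Sum>i\<in>S. real n / real m)"
    using assms by (intro sum.mono_neutral_cong_right) (auto simp: S_def group_coeff_def split: if_splits)
  also have "\<dots> = real n" using assms by (simp add: S_def)
  finally show ?thesis .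
qed

context hard_chain
begin

lemma mean_squared_smooth_hard:
  assumes "n > 0" and c: "\<And>i k. 0 \<le> c i k \<and> c i k \<le> 3"
  shows "mean_squared_smooth n N (13 * lam) (\<lambda>i. hard (c i))"
  unfolding mean_squared_smooth_def
proof (intro conjI allI ballI impI)
  note grad = hard_has_gradient[of "c i" for i, OF c]
  show "differentiable_fun N (hard (c i))" for i
    unfolding differentiable_fun_def using grad by blast
  fix x x' :: "real vec" assume x: "x \<in> carrier_vec N" "x' \<in> carrier_vec N"
  have "(\<Sum>i<n. (vnorm (gradient N (hard (c i)) x - gradient N (hard (c i)) x'))\<^sup>2)
      \<le> (\<Sum>i<n. (13 * lam)\<^sup>2 * (vnorm (x - x'))\<^sup>2)"
    using hard_grad_lipschitz[OF c x] by (intro sum_mono) (simp add: gradient_eqI[OF grad] x)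
  then show "1 / real n * (\<Sum>i<n. (vnorm (gradient N (hard (c i)) x - gradient N (hard (c i)) x'))\<^sup>2)
      \<le> (13 * lam)\<^sup>2 * (vnorm (x - x'))\<^sup>2"
    using assms(1) by (simp add: field_simps)
qed

lemma PL_hard:
  assumes "\<mu> > 0" "30000 * \<mu> \<le> lam * (1 - r\<^sup>2)"
  shows "PL N \<mu> (hard (\<lambda>_. 1))"
  unfolding PL_def
proof (intro conjI ballI)
  have grad: "has_gradient N (hard (\<lambda>_. 1)) (hard_grad (\<lambda>_. 1) x) x" if "x \<in> carrier_vec N" for x
    using that by (intro hard_has_gradient) auto
  then show "differentiable_fun N (hard (\<lambda>_. 1))" unfolding differentiable_fun_def by blast
  show "bdd_below (hard (\<lambda>_. 1) ` carrier_vec N)" by (rule inf_hard) simp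
  fix x :: "real vec" assume x: "x \<in> carrier_vec N"
  define F g where "F = hard (\<lambda>_. 1) x" and "g = (vnorm (hard_grad (\<lambda>_. 1) x))\<^sup>2"
  have F: "0 \<le> F" unfolding F_def by (rule hard_nonneg) simp
  have "(1 - r\<^sup>2) * F * lam \<le> 15000 * g"
    using hard_PL[OF x] lam by (simp add: F_def g_def field_simps)
  moreover have "30000 * \<mu> * F \<le> lam * (1 - r\<^sup>2) * F" using assms(2) F by (rule mult_right_mono)
  ultimately have "2 * \<mu> * F \<le> g" by (simp add: mult.commute mult.left_commute)
  then have "F \<le> 1 / (2 * \<mu>) * g" using assms(1) by (simp add: field_simps)
  then show "hard (\<lambda>_. 1) x - inf_value N (hard (\<lambda>_. 1)) \<le> 1 / (2 * \<mu>) * (vnorm (gradient N (hard (\<lambda>_. 1)) x))\<^sup>2"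
    using inf_hard(2)[of "\<lambda>_. 1"] gradient_eqI[OF grad[OF x]] by (simp add: F_def g_def)
qed

text \<open>Two consecutive links of the chain belong to the two ends of the path, whose distance is
  \<open>D\<close>; agent \<open>i\<close> can learn coordinate \<open>j\<close> only after \<open>j\<close> traversals and the way from the end
  that reveals it. Positions are clamped to the gap between the two groups.\<close>

lemma run_lower_bound:
  fixes n m D :: nat
  assumes n: "n \<ge> 2" "1 \<le> m" "n \<le> 3 * m" "D = n - 2 * m + 1" "2 * m \<le> n"
    and f: "f = (\<lambda>i. hard (group_coeff n m i))"
    and run: "DFO_run n N (path_edges n) f \<tau> M out" and \<tau>: "\<tau> > 0"
    and out: "i < n" "s \<ge> 0" "out i s = Some x"
    and j: "K \<le> j" "j < N" "x $ j \<noteq> 0"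
  shows "real K * (1 + \<tau> * real D) \<le> s \<and> K * D \<le> comm_rounds n N f \<tau> M s"
proof -
  define p where "p i = min (Suc i - m) D" for i
  \<comment> \<open>Even coordinates originate in the first group, where \<open>p i = 0\<close>, and
    odd ones in the last, where \<open>p i = D\<close>. \<open>j * D\<close> counts the traversals
    before coordinate \<open>j\<close> exists, the rest is the way from its origin.\<close>
  define \<nu> where "\<nu> i j = j * D + (if even j then p i else D - p i)" for i j
  have grad: "has_gradient N (f i) (hard_grad (group_coeff n m i) x) x" if "x \<in> carrier_vec N" for i x
    unfolding f using that group_coeff_bounds[OF n(2,3)] by (intro hard_has_gradient) auto
  have grad_eq: "gradient N (f i) x = hard_grad (group_coeff n m i) x" if "x \<in> carrier_vec N" for i x
    using gradient_eqI[OF grad[OF that]] .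
  have "x \<in> M i s" using run out unfolding DFO_run_def by blast
  have "x \<in> carrier_vec N \<and> (\<forall>j<N. x $ j \<noteq> 0 \<longrightarrow>
    real (Suc j) + \<tau> * real (\<nu> i j) \<le> s \<and> \<nu> i j \<le> comm_rounds n N f \<tau> M s)"
  proof (rule DFO_progress[OF run \<tau> _ _ _ out(1,2) \<open>x \<in> M i s\<close>])
    fix i i' j assume "(i, i') \<in> path_edges n"
    then have "i' < n" "i \<le> Suc i'" "i' \<le> Suc i" by (auto simp: path_edges_def)
    then show "i' < n \<and> \<nu> i j \<le> Suc (\<nu> i' j)" by (auto simp: \<nu>_def p_def)
  next
    fix i x j assume *: "i < n" "x \<in> carrier_vec N" "j < N" "gradient N (f i) x $ j \<noteq> 0"
    \<comment> \<open>Where coordinate \<open>j\<close> originates, coordinate \<open>j - 1\<close>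
      arrives only after crossing the whole gap, so both have the same level.\<close>
    have own: "\<nu> i j = j * D \<and> (0 < j \<longrightarrow> \<nu> i (j - 1) = j * D)" if "group_coeff n m i (Suc j) \<noteq> 0"
    proof -
      have "even j \<and> p i = 0 \<or> odd j \<and> p i = D"
        using that n by (auto simp: group_coeff_def p_def split: if_splits)
      then show ?thesis by (cases j) (auto simp: \<nu>_def)
    qed
    consider "x $ j \<noteq> 0" | "group_coeff n m i (Suc j) \<noteq> 0" "j = 0 \<or> x $ (j - 1) \<noteq> 0"
      | "Suc j < N" "x $ (Suc j) \<noteq> 0"
      using hard_grad_reveals[OF *(3), of "group_coeff n m i" x] *(4) unfolding grad_eq[OF *(2)] by blast
    then show "j = 0 \<and> \<nu> i j = 0 \<or> (\<exists>j'<N. x $ j' \<noteq> 0 \<and> j \<le> Suc j' \<and> \<nu> i j \<le> \<nu> i j')"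
    proof cases
      case 1
      with *(3) show ?thesis by auto
    next
      case 2
      show ?thesis
      proof (cases "j = 0")
        case False
        with 2 own *(3) show ?thesis by (intro disjI2 exI[of _ "j - 1"]) auto
      qed (use own 2 in auto)
    next
      case 3
      moreover have "\<nu> i j \<le> \<nu> i (Suc j)" by (auto simp: \<nu>_def p_def)
      ultimately show ?thesis by auto
    qed
  qed (simp add: grad_eq)
  then have *: "real (Suc j) + \<tau> * real (\<nu> i j) \<le> s" "\<nu> i j \<le> comm_rounds n N f \<tau> M s" using j by auto
  have KD: "K * D \<le> \<nu> i j" using j(1) by (simp add: \<nu>_def trans_le_add1)
  then have "\<tau> * (real K * real D) \<le> \<tau> * real (\<nu> i j)"
    using \<tau> by (intro mult_left_mono) (simp_all flip: of_nat_mult)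
  then have "real K * (1 + \<tau> * real D) \<le> s" using * j(1) by (simp add: algebra_simps)
  then show ?thesis using * KD by simp
qed

end

text \<open>With \<open>q = 1 - 1 / T\<close> and \<open>K\<close> about
  \<open>T * ln (\<Delta> / \<epsilon>) / 4\<close>, the power \<open>q ^ K\<close> is at least the
  square root of \<epsilon>/\<Delta>, far above \<epsilon>/\<Delta>. It is also at most 1/2, so
  cutting the chain at \<open>2 * K\<close> removes at most half of the tail.\<close>

lemma chain_length:
  fixes \<Delta> \<epsilon> T :: real
  assumes "0 < \<epsilon>" "\<epsilon> < 0.01 * \<Delta>" "T \<ge> 9"
  obtains K where "1 \<le> K" "T * ln (\<Delta> / \<epsilon>) / 8 \<le> real K" "real K \<le> T * ln (\<Delta> / \<epsilon>) / 4"
    "\<epsilon> < 9/40 * \<Delta> * ((1 - 1 / T) ^ K - (1 - 1 / T) ^ (2 * K))"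
proof -
  define l q where "l = ln (\<Delta> / \<epsilon>)" and "q = 1 - 1 / T"
  have \<epsilon>: "\<epsilon> < \<Delta> / 100" using assms(2) by simp
  then have \<Delta>: "\<Delta> > 0" using assms(1) by linarith
  have ratio: "\<Delta> / \<epsilon> > 100" using assms by (simp add: field_simps)
  have "exp 4 \<le> (100 :: real)"
  proof -
    have "exp (4 :: real) = exp 1 ^ 4" by (simp add: exp_of_nat_mult[of 4 1, simplified])
    also have "\<dots> \<le> 3 ^ 4" using exp_le by (intro power_mono) auto
    finally show ?thesis by simp
  qed
  then have l: "l \<ge> 4" unfolding l_def using ratio by (subst ln_ge_iff) auto
  have Tl: "T * l \<ge> 36" using mult_mono[of 9 T 4 l] assms(3) l by simp
  define K where "K = nat \<lfloor>T * l / 4\<rfloor>"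
  have K: "real K \<le> T * l / 4" "T * l / 4 - 1 < real K" using Tl by (simp_all add: K_def) linarith
  have q: "0 < q" "q < 1" using assms(3) by (simp_all add: q_def field_simps)
  have invT: "0 < 1 / T" "1 / T \<le> 1/9" using assms(3) by (simp_all add: field_simps)
  have lower: "exp (- (l / 2)) \<le> q ^ K"
  proof -
    \<comment> \<open>Uses \<open>ln (1 - x) \<ge> - x - 2 * x\<^sup>2 \<ge> - 2 * x\<close> at
      \<open>x = 1 / T\<close>, which is at most 1/2.\<close>
    have "- (2 / T) \<le> - (1 / T) - 2 * (1 / T)\<^sup>2"
      using mult_right_mono[of "1 / T" "1/2" "1 / T"] invT by (simp add: power2_eq_square)
    also have "\<dots> \<le> ln q" unfolding q_def using invT by (intro ln_one_minus_pos_lower_bound) auto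
    finally have "real K * - (2 / T) \<le> real K * ln q" by (intro mult_left_mono) auto
    moreover have "- (l / 2) \<le> real K * - (2 / T)"
      using K(1) assms(3) by (simp add: field_simps)
    ultimately have "exp (- (l / 2)) \<le> exp (real K * ln q)" by simp
    also have "\<dots> = q ^ K" using q by (simp add: exp_of_nat_mult)
    finally show ?thesis .
  qed
  have upper: "q ^ K \<le> 1/2"
  proof -
    \<comment> \<open>From \<open>l \<ge> 4\<close> and \<open>T \<ge> 9\<close>: \<open>K\<close>
      exceeds \<open>T - 1\<close>, which is at least 8/9 of \<open>T\<close>.\<close>
    have "8/10 \<le> real K / T"
    proof -
      have "T * 4 \<le> T * l" using l assms(3) by (intro mult_left_mono) auto
      then have "T * (8/10) \<le> real K" using K(2) assms(3) by linarith
      then show ?thesis using assms(3) by (simp add: field_simps)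
    qed
    have "q \<le> exp (- (1 / T))" unfolding q_def using exp_ge_add_one_self[of "- (1 / T)"] by simp
    then have "q ^ K \<le> exp (- (1 / T)) ^ K" using q by (intro power_mono) auto
    also have "\<dots> = exp (- (real K / T))" by (simp add: exp_of_nat_mult[symmetric])
    also have "\<dots> \<le> exp (- (8/10))" using \<open>8/10 \<le> real K / T\<close> by simp
    also have "\<dots> = inverse (exp (8/10))" by (rule exp_minus)
    also have "\<dots> \<le> inverse 2"
    proof (rule le_imp_inverse_le)
      have "2 \<le> 1 + 8/10 + (8/10)\<^sup>2 / (2 :: real)" by (simp add: power2_eq_square)
      also have "\<dots> \<le> exp (8/10)" by (rule exp_lower_Taylor_quadratic) simp
      finally show "(2 :: real) \<le> exp (8/10)" .
    qed simp
    also have "inverse 2 = (1/2 :: real)" by simp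
    finally show ?thesis .
  qed
  define e where "e = exp (- (l / 2))"
  have e2: "e * e = \<epsilon> / \<Delta>"
  proof -
    have "e * e = exp (- l)" unfolding e_def exp_add[symmetric] by simp
    also have "\<dots> = \<epsilon> / \<Delta>" using assms(1) \<Delta> by (simp add: l_def exp_minus)
    finally show ?thesis .
  qed
  have "e < 1/10"
  proof (rule ccontr)
    assume "\<not> e < 1/10"
    then have "1/10 * (1/10) \<le> e * e" by (intro mult_mono) auto
    then show False using e2 assms(2) \<Delta> by (simp add: field_simps)
  qed
  have "e > 0" by (simp add: e_def)
  have "q ^ K * q ^ K \<le> 1/2 * q ^ K" using upper q by (intro mult_right_mono) auto
  then have "1/2 * e \<le> q ^ K - q ^ (2 * K)"
    using lower by (simp add: e_def power_add[symmetric] mult_2)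
  then have "9/40 * \<Delta> * (1/2 * e) \<le> 9/40 * \<Delta> * (q ^ K - q ^ (2 * K))"
    using \<Delta> by (intro mult_left_mono) auto
  \<comment> \<open>\<open>e\<close> is the square root of \<epsilon>/\<Delta>; the constants fit
    because \<open>e\<close> is below 1/10, hence below 9/80.\<close>
  moreover have "\<epsilon> < 9/40 * \<Delta> * (1/2 * e)"
  proof -
    have "\<epsilon> = \<Delta> * (e * e)" using e2 \<Delta> by simp
    also have "\<dots> < \<Delta> * (9/80 * e)" using \<open>e < 1/10\<close> \<open>e > 0\<close> \<Delta> by simp
    finally show ?thesis by simp
  qed
  ultimately have "\<epsilon> < 9/40 * \<Delta> * (q ^ K - q ^ (2 * K))" by linarith
  moreover have "1 \<le> K" "T * l / 8 \<le> real K" using K(2) Tl by linarith+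
  ultimately show ?thesis using that[of K] K(1) by (simp add: l_def q_def)
qed

theorem theorem4p3:
  fixes \<Delta> a :: real
  assumes "a = 19708" and "\<Delta> > 0"
  shows "\<exists>C>0. \<exists>c\<^sub>1>0. \<exists>c\<^sub>2>0. \<forall>L \<mu> \<epsilon> \<gamma> \<kappa> :: real.
    L > 0 \<and> \<mu> > 0 \<and> \<epsilon> > 0 \<and> L \<ge> 194 * a * \<mu> \<and> 0 < \<gamma> \<and> \<gamma> \<le> 1 \<and> \<epsilon> < 0.01 * \<Delta> \<and> \<kappa> = L / \<mu> \<longrightarrow>
    (\<exists>n\<ge>2. \<exists>E W. \<exists>d\<ge>1. \<exists>f.
       connected_network n E \<and> mixing_matrix n E W \<and> 1 - lambda2 W \<ge> \<gamma> \<and>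
       real d \<le> C * (\<kappa> * max 1 (ln (1 / \<epsilon>))) \<and>
       mean_squared_smooth n d L f \<and>
       PL d \<mu> (average n f) \<and>
       average n f (0\<^sub>v d) - inf_value d (average n f) \<le> \<Delta> \<and>
       spectral_gap W = \<gamma> \<and>
       (\<forall>\<tau>>0. \<forall>M out. DFO_run n d E f \<tau> M out \<longrightarrow>
          (\<forall>i<n. \<forall>s\<ge>0. \<forall>x. out i s = Some x \<and> suboptimal d (average n f) \<epsilon> x \<longrightarrow>
             real (comm_rounds n d f \<tau> M s) \<ge> c\<^sub>1 * (\<kappa> / sqrt \<gamma> * ln (1 / \<epsilon>)) \<and>
             s \<ge> c\<^sub>2 * (\<kappa> * ln (1 / \<epsilon>) * (1 + \<tau> / sqrt \<gamma>)))))"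
proof -
  \<comment> \<open>Converts between the logarithms of \<Delta>/\<epsilon> and 1/\<epsilon>; it
    depends on \<Delta> only.\<close>
  define B where "B = 1 + \<bar>ln \<Delta>\<bar>"
  \<comment> \<open>390000 relates \<open>T\<close> to \<kappa>; 192 = 8 * 24 collects the losses in
    \<open>K \<ge> T * l / 8\<close> and \<open>D \<ge> 1 / (24 * sqrt \<gamma>)\<close>.\<close>
  define c where "c = 1 / (390000 * 192 * B)"
  have B: "B \<ge> 1" by (simp add: B_def)
  have c: "c > 0" using B by (simp add: c_def)
  show ?thesis
  proof (rule exI[of _ B], intro conjI, use B in simp, rule exI[of _ c], intro conjI, rule c,
      rule exI[of _ c], intro conjI, rule c, intro allI impI, elim conjE)
    fix L \<mu> \<epsilon> \<gamma> \<kappa> :: real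
    assume L: "L > 0" "L \<ge> 194 * a * \<mu>" and \<mu>: "\<mu> > 0" and \<epsilon>: "\<epsilon> > 0" "\<epsilon> < 0.01 * \<Delta>"
      and \<gamma>: "0 < \<gamma>" "\<gamma> \<le> 1" and \<kappa>: "\<kappa> = L / \<mu>"
    \<comment> \<open>The smoothness constant \<open>13 * lam\<close> becomes \<open>L\<close>, and
      with \<open>1 - r\<^sup>2 = 1 / T\<close> the PL requirement holds with equality, since 390000
      = 13 * 30000.\<close>
    define T lam where "T = \<kappa> / 390000" and "lam = L / 13"
    have "\<kappa> \<ge> 194 * 19708" using L \<mu> assms(1) by (simp add: \<kappa> field_simps)
    then have T: "T \<ge> 9" by (simp add: T_def)
    \<comment> \<open>\<open>A\<close> is chosen so that the bound
      \<open>lam * A\<^sup>2 / (1 - r\<^sup>2)\<close> on the value at the origin equals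
      \<Delta>.\<close>
    define r A l where "r = sqrt (1 - 1 / T)" and "A = sqrt (\<Delta> / (lam * T))" and "l = ln (\<Delta> / \<epsilon>)"
    have lam: "lam > 0" using L by (simp add: lam_def)
    have q: "0 < 1 - 1 / T" "3/4 \<le> 1 - 1 / T" "1 - 1 / T < 1" using T by (simp_all add: field_simps)
    then have r2: "r\<^sup>2 = 1 - 1 / T" by (simp add: r_def)
    have A2: "A\<^sup>2 = \<Delta> / (lam * T)" using lam T assms(2) by (simp add: A_def)
    have scale: "lam * A\<^sup>2 / (1 - r\<^sup>2) = \<Delta>" unfolding A2 r2 using lam T by simp
    obtain K where K: "1 \<le> K" "T * l / 8 \<le> real K" "real K \<le> T * l / 4"
      "\<epsilon> < 9/40 * \<Delta> * ((1 - 1 / T) ^ K - (1 - 1 / T) ^ (2 * K))"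
      using chain_length[OF \<epsilon> T] unfolding l_def .
    \<comment> \<open>Half of the chain must be unfrozen before the value can drop to \<epsilon>;
      the other half provides the tail.\<close>
    interpret hard_chain "2 * K" r A lam
    proof
      show "0 < r" using q(1) by (simp add: r_def)
      show "0 < A" using lam T assms(2) by (simp add: A_def)
    qed (use K(1) q r2 lam in auto)
    obtain n w where n: "n \<ge> 2" and W: "mixing_matrix n (path_edges n) (path_mix n w)"
      "spectral_gap (path_mix n w) = \<gamma>" and n\<gamma>: "1 / (4 * sqrt \<gamma>) \<le> real n"
      using path_with_spectral_gap[OF \<gamma>] .
    \<comment> \<open>\<open>m\<close> is a third of \<open>n\<close>, rounded up; \<open>D\<close>
      is the distance between the two groups, at least \<open>n / 6\<close> because
      \<open>n \<ge> 2\<close>.\<close>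
    define m D where "m = (n + 2) div 3" and "D = n - 2 * m + 1"
    have m: "1 \<le> m" "n \<le> 3 * m" "2 * m \<le> n" "n \<le> 6 * D"
    proof -
      have "3 * m \<le> n + 2" "n + 2 < 3 * m + 3" unfolding m_def by linarith+
      then show "1 \<le> m" "n \<le> 3 * m" "2 * m \<le> n" using n by linarith+
      then have "D + 2 * m = n + 1" by (simp add: D_def)
      with \<open>3 * m \<le> n + 2\<close> show "n \<le> 6 * D" using n by linarith
    qed
    have D: "1 / (24 * sqrt \<gamma>) \<le> real D"
    proof -
      have "1 / (4 * sqrt \<gamma>) \<le> 6 * real D" using n\<gamma> m(4) by linarith
      then show ?thesis using \<gamma> by (simp add: field_simps)
    qed
    define f where "f = (\<lambda>i. hard (group_coeff n m i))"
    have avg: "average n f = hard (\<lambda>_. 1)"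
      unfolding f_def using n m group_coeff_sum[of m n] by (intro average_hard) auto
    have inf: "inf_value (2 * K) (hard (\<lambda>_. 1)) = 0" by (rule inf_hard) simp
    have logs: "l \<le> B * max 1 (ln (1 / \<epsilon>))" "ln (1 / \<epsilon>) \<le> B * l" "4 \<le> T * l"
    proof -
      have l: "l = ln \<Delta> + ln (1 / \<epsilon>)" using \<epsilon> assms(2) by (simp add: l_def ln_div)
      have "\<bar>ln \<Delta>\<bar> \<le> \<bar>ln \<Delta>\<bar> * max 1 (ln (1 / \<epsilon>))" by (simp add: mult_le_cancel_left1)
      then show "l \<le> B * max 1 (ln (1 / \<epsilon>))" unfolding l B_def distrib_right by linarith
      have "\<Delta> / \<epsilon> > 100" using \<epsilon> by (simp add: field_simps)
      moreover have "exp (1 :: real) \<le> 100" using exp_le by linarith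
      ultimately have "1 \<le> l" unfolding l_def by (subst ln_ge_iff) auto
      then have "\<bar>ln \<Delta>\<bar> \<le> \<bar>ln \<Delta>\<bar> * l" by (simp add: mult_le_cancel_left1)
      then show "ln (1 / \<epsilon>) \<le> B * l" unfolding B_def distrib_right using l by linarith
      show "4 \<le> T * l" using K(1,3) by linarith
    qed
    have \<kappa>pos: "\<kappa> > 0" using L \<mu> by (simp add: \<kappa>)
    have small: "c * (\<kappa> * ln (1 / \<epsilon>)) \<le> T * l / 192"
    proof -
      have "c * (\<kappa> * ln (1 / \<epsilon>)) \<le> c * (\<kappa> * (B * l))"
        using logs(2) \<kappa>pos c by (intro mult_left_mono) auto
      also have "\<dots> = T * l / 192" using B by (simp add: c_def T_def field_simps)
      finally show ?thesis .
    qed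
    have bounds: "real (comm_rounds n (2 * K) f \<tau> M s) \<ge> c * (\<kappa> / sqrt \<gamma> * ln (1 / \<epsilon>)) \<and>
        s \<ge> c * (\<kappa> * ln (1 / \<epsilon>) * (1 + \<tau> / sqrt \<gamma>))"
      if \<tau>: "\<tau> > 0" and run: "DFO_run n (2 * K) (path_edges n) f \<tau> M out"
        and i: "i < n" "s \<ge> 0" "out i s = Some x" and sub: "suboptimal (2 * K) (average n f) \<epsilon> x"
      for \<tau> M out i s x
    proof -
      have "hard (\<lambda>_. 1) x \<le> \<epsilon>" using sub by (simp add: suboptimal_def avg inf)
      moreover have "9/40 * \<Delta> * ((1 - 1 / T) ^ K - (1 - 1 / T) ^ (2 * K)) \<le> hard (\<lambda>_. 1) x"
        if "\<And>j. K \<le> j \<Longrightarrow> j < 2 * K \<Longrightarrow> x $ j = 0"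
        using hard_unrevealed[of K x, OF _ that, unfolded scale, unfolded r2] by simp
      \<comment> \<open>If the second half of the coordinates were still zero, the value would
        exceed \<epsilon>.\<close>
      ultimately obtain j where j: "K \<le> j" "j < 2 * K" "x $ j \<noteq> 0" using K(4) by fastforce
      from run_lower_bound[OF n m(1,2) D_def m(3) f_def run \<tau> i j]
      have lb: "real K * (1 + \<tau> * real D) \<le> s" "K * D \<le> comm_rounds n (2 * K) f \<tau> M s" by auto
      have sq: "sqrt \<gamma> > 0" using \<gamma> by simp
      have "c * (\<kappa> / sqrt \<gamma> * ln (1 / \<epsilon>)) = c * (\<kappa> * ln (1 / \<epsilon>)) * (1 / sqrt \<gamma>)" by simp
      also have "\<dots> \<le> T * l / 192 * (1 / sqrt \<gamma>)" using small sq by (intro mult_right_mono) auto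
      also have "\<dots> = T * l / 8 * (1 / (24 * sqrt \<gamma>))" by simp
      also have "\<dots> \<le> real K * real D" using K(2) D sq by (intro mult_mono) auto
      also have "\<dots> \<le> real (comm_rounds n (2 * K) f \<tau> M s)" using lb(2) by (simp flip: of_nat_mult)
      finally have rounds: "c * (\<kappa> / sqrt \<gamma> * ln (1 / \<epsilon>)) \<le> real (comm_rounds n (2 * K) f \<tau> M s)" .
      have "c * (\<kappa> * ln (1 / \<epsilon>) * (1 + \<tau> / sqrt \<gamma>)) = c * (\<kappa> * ln (1 / \<epsilon>)) * (1 + \<tau> / sqrt \<gamma>)" by simp
      also have "\<dots> \<le> T * l / 192 * (1 + \<tau> / sqrt \<gamma>)"
        using small sq \<tau> by (intro mult_right_mono) auto
      also have "\<dots> = T * l / 8 * (1/24 + \<tau> * (1 / (24 * sqrt \<gamma>)))" using sq by (simp add: field_simps)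
      also have "\<dots> \<le> real K * (1 + \<tau> * real D)"
        using K(2) D sq \<tau> by (intro mult_mono add_mono) auto
      finally show ?thesis using rounds lb(1) by linarith
    qed
    show "\<exists>n\<ge>2. \<exists>E W. \<exists>d\<ge>1. \<exists>f.
       connected_network n E \<and> mixing_matrix n E W \<and> 1 - lambda2 W \<ge> \<gamma> \<and>
       real d \<le> B * (\<kappa> * max 1 (ln (1 / \<epsilon>))) \<and>
       mean_squared_smooth n d L f \<and>
       PL d \<mu> (average n f) \<and>
       average n f (0\<^sub>v d) - inf_value d (average n f) \<le> \<Delta> \<and>
       spectral_gap W = \<gamma> \<and>
       (\<forall>\<tau>>0. \<forall>M out. DFO_run n d E f \<tau> M out \<longrightarrow>
          (\<forall>i<n. \<forall>s\<ge>0. \<forall>x. out i s = Some x \<and> suboptimal d (average n f) \<epsilon> x \<longrightarrow>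
             real (comm_rounds n d f \<tau> M s) \<ge> c * (\<kappa> / sqrt \<gamma> * ln (1 / \<epsilon>)) \<and>
             s \<ge> c * (\<kappa> * ln (1 / \<epsilon>) * (1 + \<tau> / sqrt \<gamma>))))"
    proof (rule exI[of _ n], rule conjI[OF n], rule exI[of _ "path_edges n"], rule exI[of _ "path_mix n w"],
        rule exI[of _ "2 * K"], rule conjI, use K(1) in simp, rule exI[of _ f], intro conjI)
      show "1 - lambda2 (path_mix n w) \<ge> \<gamma>" using W(2) by (simp add: spectral_gap_def)
      show "real (2 * K) \<le> B * (\<kappa> * max 1 (ln (1 / \<epsilon>)))"
      proof -
        have "real (2 * K) \<le> \<kappa> * l" using K(3) logs(3) by (simp add: T_def)
        also have "\<dots> \<le> \<kappa> * (B * max 1 (ln (1 / \<epsilon>)))" using logs(1) \<kappa>pos by (intro mult_left_mono) auto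
        finally show ?thesis by (simp add: mult.left_commute)
      qed
      show "mean_squared_smooth n (2 * K) L f"
        using mean_squared_smooth_hard[of n "group_coeff n m"] group_coeff_bounds[OF m(1,2)] n
        by (simp add: f_def lam_def)
      have "30000 * \<mu> \<le> lam * (1 - r\<^sup>2)"
        unfolding r2 lam_def T_def \<kappa> using L \<mu> by simp
      then show "PL (2 * K) \<mu> (average n f)" unfolding avg by (rule PL_hard[OF \<mu>])
      show "average n f (0\<^sub>v (2 * K)) - inf_value (2 * K) (average n f) \<le> \<Delta>"
        using hard_origin unfolding avg inf scale by simp
      show "\<forall>\<tau>>0. \<forall>M out. DFO_run n (2 * K) (path_edges n) f \<tau> M out \<longrightarrow>
          (\<forall>i<n. \<forall>s\<ge>0. \<forall>x. out i s = Some x \<and> suboptimal (2 * K) (average n f) \<epsilon> x \<longrightarrow>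
             real (comm_rounds n (2 * K) f \<tau> M s) \<ge> c * (\<kappa> / sqrt \<gamma> * ln (1 / \<epsilon>)) \<and>
             s \<ge> c * (\<kappa> * ln (1 / \<epsilon>) * (1 + \<tau> / sqrt \<gamma>)))"
        using bounds by blast
    qed (use W connected_path in auto)
  qed
qed

end
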